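(* Let $A$ be an $m\times n$ matrix over a field $F$. There is a randomized algorithm that computes $\operatorname{rank}(A)$ dynamically, using $\tilde O(mn)$ field operations per update in the worst case, supporting the following update operations on $A$: rank one updates, adding a row, deleting a row, adding a column, and deleting a column.
   Context: A rank one update replaces $A$ by $A+uv^{T}$ for given column vectors $u,v$ of the appropriate dimensions. In the dynamic problem a sequence of updates is applied to $A$ one after another, and after each update the data structure must report the rank of the current matrix; $m$ and $n$ in the bound $\tilde O(mn)$ are the dimensions of the current matrix. $\tilde O$ hides polylogarithmic factors. "Randomized" means that all reported ranks are correct with high probability: if $Q$ is an upper bound on the number of updates, the computation is carried out over a field whose size is a sufficiently large polynomial in $m$, $n$ and $Q$ (an extension of $F$ if necessary), and the probability that any error occurs during the whole execution is at most inverse polynomial in the dimensions and $Q$. Field operations are counted in that field, and the algorithm may draw uniformly random elements of it (of a sufficiently large finite subset, if it is infinite). *)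

theory Defs
  imports
    "HOL-Probability.Probability"
    "HOL-Algebra.Algebraic_Closure_Type"
    "Jordan_Normal_Form.DL_Rank"
begin

section \<open>The dynamic problem\<close>

text \<open>
  Rows and columns may be inserted at any position: \<open>Add_Row i v\<close> makes \<open>v\<close> the new row number \<open>i\<close>
  (counted from 0) and shifts the later rows, so \<open>i = dim_row A\<close> appends.  A deletion closes the
  gap.  Matrices without rows or without columns are allowed.
\<close>

datatype 'a update =
    Rank_One "'a vec" "'a vec"
  | Add_Row nat "'a vec"
  | Delete_Row nat
  | Add_Col nat "'a vec"
  | Delete_Col nat

fun valid_update :: "'a mat \<Rightarrow> 'a update \<Rightarrow> bool" where
  "valid_update A (Rank_One u v) \<longleftrightarrow> u \<in> carrier_vec (dim_row A) \<and> v \<in> carrier_vec (dim_col A)"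
| "valid_update A (Add_Row i v) \<longleftrightarrow> i \<le> dim_row A \<and> v \<in> carrier_vec (dim_col A)"
| "valid_update A (Delete_Row i) \<longleftrightarrow> i < dim_row A"
| "valid_update A (Add_Col j v) \<longleftrightarrow> j \<le> dim_col A \<and> v \<in> carrier_vec (dim_row A)"
| "valid_update A (Delete_Col j) \<longleftrightarrow> j < dim_col A"

fun apply_update :: "'a::semiring_0 mat \<Rightarrow> 'a update \<Rightarrow> 'a mat" where
  "apply_update A (Rank_One u v) = A + mat_of_cols (dim_row A) [u] * mat_of_rows (dim_col A) [v]"
| "apply_update A (Add_Row i v) =
     mat_of_rows (dim_col A) (take i (rows A) @ v # drop i (rows A))"
| "apply_update A (Delete_Row i) =
     mat_of_rows (dim_col A) (take i (rows A) @ drop (Suc i) (rows A))"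
| "apply_update A (Add_Col j v) =
     mat_of_cols (dim_row A) (take j (cols A) @ v # drop j (cols A))"
| "apply_update A (Delete_Col j) =
     mat_of_cols (dim_row A) (take j (cols A) @ drop (Suc j) (cols A))"

fun valid_updates :: "'a::semiring_0 mat \<Rightarrow> 'a update list \<Rightarrow> bool" where
  "valid_updates A [] \<longleftrightarrow> True"
| "valid_updates A (u # us) \<longleftrightarrow> valid_update A u \<and> valid_updates (apply_update A u) us"

fun history :: "'a::semiring_0 mat \<Rightarrow> 'a update list \<Rightarrow> 'a mat list" where
  "history A [] = [A]"
| "history A (u # us) = A # history (apply_update A u) us"

definition mat_rank :: "'a::field mat \<Rightarrow> nat" where
  "mat_rank A = vec_space.rank (dim_row A) A"


section \<open>Algorithms: programs of an algebraic random access machine\<close>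

text \<open>
  A machine has index registers and arrays of natural numbers for addressing and control, and
  two-dimensional arrays of field elements.  Every instruction performs at most one field operation.
  Index arithmetic is restricted to successor and predecessor, so that large integers cannot be used
  to pack data.  Programs mention no field element except 0 and 1, and one program works for all
  dimensions.
\<close>

datatype atom = Const nat | Reg nat

datatype cell = Cell nat atom atom

datatype instr =
    IMove nat atom
  | IInc nat
  | IDec nat
  | ILoad nat nat atom
  | IStore nat atom atom
  | FZero cell
  | FOne cell
  | FCopy cell cell
  | FAdd cell cell cell
  | FSub cell cell cell
  | FMul cell cell cell
  | FDiv cell cell cell
  | FDraw cell

datatype test =
    Less atom atom
  | Equal atom atom
  | Is_Zero cell
  | Negate test

datatype com =
    Do instr
  | Seq com com
  | Cond test com com
  | While test com

record 'k state =
  regs :: "nat \<Rightarrow> nat"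
  idx :: "nat \<Rightarrow> nat \<Rightarrow> nat"
  mem :: "nat \<Rightarrow> nat \<Rightarrow> nat \<Rightarrow> 'k"
  drawn :: nat

fun atom_val :: "'k state \<Rightarrow> atom \<Rightarrow> nat" where
  "atom_val s (Const c) = c"
| "atom_val s (Reg r) = regs s r"

fun get :: "'k state \<Rightarrow> cell \<Rightarrow> 'k" where
  "get s (Cell a i j) = mem s a (atom_val s i) (atom_val s j)"

fun put :: "cell \<Rightarrow> 'k \<Rightarrow> 'k state \<Rightarrow> 'k state" where
  "put (Cell a i j) x s =
     s\<lparr>mem := (mem s)(a := (mem s a)(atom_val s i := (mem s a (atom_val s i))(atom_val s j := x)))\<rparr>"

definition set_reg :: "nat \<Rightarrow> nat \<Rightarrow> 'k state \<Rightarrow> 'k state" where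
  "set_reg r x s = s\<lparr>regs := (regs s)(r := x)\<rparr>"

text \<open>
  Randomness is an infinite tape \<open>\<omega>\<close> of field elements, read from left to right; \<open>drawn s\<close> is the
  number of entries already consumed.  Dividing by zero yields 0, as usual in HOL.
\<close>

fun exec_instr :: "(nat \<Rightarrow> 'k::field) \<Rightarrow> instr \<Rightarrow> 'k state \<Rightarrow> 'k state" where
  "exec_instr \<omega> (IMove r a) s = set_reg r (atom_val s a) s"
| "exec_instr \<omega> (IInc r) s = set_reg r (regs s r + 1) s"
| "exec_instr \<omega> (IDec r) s = set_reg r (regs s r - 1) s"
| "exec_instr \<omega> (ILoad r b a) s = set_reg r (idx s b (atom_val s a)) s"
| "exec_instr \<omega> (IStore b a c) s =
     s\<lparr>idx := (idx s)(b := (idx s b)(atom_val s a := atom_val s c))\<rparr>"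
| "exec_instr \<omega> (FZero x) s = put x 0 s"
| "exec_instr \<omega> (FOne x) s = put x 1 s"
| "exec_instr \<omega> (FCopy x y) s = put x (get s y) s"
| "exec_instr \<omega> (FAdd x y z) s = put x (get s y + get s z) s"
| "exec_instr \<omega> (FSub x y z) s = put x (get s y - get s z) s"
| "exec_instr \<omega> (FMul x y z) s = put x (get s y * get s z) s"
| "exec_instr \<omega> (FDiv x y z) s = put x (get s y / get s z) s"
| "exec_instr \<omega> (FDraw x) s = (put x (\<omega> (drawn s)) s)\<lparr>drawn := Suc (drawn s)\<rparr>"

fun test_val :: "'k::zero state \<Rightarrow> test \<Rightarrow> bool" where
  "test_val s (Less a b) \<longleftrightarrow> atom_val s a < atom_val s b"
| "test_val s (Equal a b) \<longleftrightarrow> atom_val s a = atom_val s b"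
| "test_val s (Is_Zero x) \<longleftrightarrow> get s x = 0"
| "test_val s (Negate b) \<longleftrightarrow> \<not> test_val s b"

text \<open>
  \<open>big_step \<omega> c s t s'\<close>: program \<open>c\<close>, started in \<open>s\<close>, halts in \<open>s'\<close> after exactly \<open>t\<close> steps.
  Field operations (arithmetic, zero tests, random draws, copies) cost 1 each.  Index instructions
  and index tests are charged as well: if they were free, a problem over a small finite field could
  be read off by a few zero tests and solved by uncounted integer computation.
\<close>

inductive big_step ::
    "(nat \<Rightarrow> 'k::field) \<Rightarrow> com \<Rightarrow> 'k state \<Rightarrow> nat \<Rightarrow> 'k state \<Rightarrow> bool" for \<omega> where
  Do: "big_step \<omega> (Do i) s 1 (exec_instr \<omega> i s)"
| Seq: "big_step \<omega> c s t s' \<Longrightarrow> big_step \<omega> c' s' t' s'' \<Longrightarrow> big_step \<omega> (Seq c c') s (t + t') s''"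
| CondT: "test_val s b \<Longrightarrow> big_step \<omega> c s t s' \<Longrightarrow> big_step \<omega> (Cond b c c') s (1 + t) s'"
| CondF: "\<not> test_val s b \<Longrightarrow> big_step \<omega> c' s t s' \<Longrightarrow> big_step \<omega> (Cond b c c') s (1 + t) s'"
| WhileF: "\<not> test_val s b \<Longrightarrow> big_step \<omega> (While b c) s 1 s"
| WhileT: "test_val s b \<Longrightarrow> big_step \<omega> c s t s' \<Longrightarrow> big_step \<omega> (While b c) s' t' s'' \<Longrightarrow>
     big_step \<omega> (While b c) s (1 + t + t') s''"


section \<open>Data structures\<close>

record dyn_algorithm =
  prog_init :: com
  prog_rank_one :: com
  prog_add_row :: com
  prog_delete_row :: com
  prog_add_col :: com
  prog_delete_col :: com

fun program_for :: "dyn_algorithm \<Rightarrow> 'a update \<Rightarrow> com" where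
  "program_for P (Rank_One u v) = prog_rank_one P"
| "program_for P (Add_Row i v) = prog_add_row P"
| "program_for P (Delete_Row i) = prog_delete_row P"
| "program_for P (Add_Col j v) = prog_add_col P"
| "program_for P (Delete_Col j) = prog_delete_col P"

text \<open>
  Computations take place in extensions of the base field \<open>'a\<close> inside its algebraic closure, so
  inputs are embedded by \<^const>\<open>to_ac\<close>.  Conventions: initially registers 0, 1, 2 hold the two
  dimensions and the bound \<open>Q\<close> on the number of updates, and array 0 holds the matrix.  The operands
  of an update are put in column 0 of the arrays 1 and 2, a position in register 0; the rest of the
  state persists from one update to the next.  Answers are read from register 0.
\<close>

definition initial_state :: "nat \<Rightarrow> 'a::field mat \<Rightarrow> 'a alg_closure state" where
  "initial_state Q A =
     \<lparr>regs = (\<lambda>_. 0)(0 := dim_row A, 1 := dim_col A, 2 := Q),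
      idx = (\<lambda>_ _. 0),
      mem = (\<lambda>_ _ _. 0)
        (0 := \<lambda>i j. if i < dim_row A \<and> j < dim_col A then to_ac (A $$ (i, j)) else 0),
      drawn = 0\<rparr>"

definition load_vec :: "nat \<Rightarrow> 'a::field vec \<Rightarrow> 'a alg_closure state \<Rightarrow> 'a alg_closure state" where
  "load_vec a v s =
     s\<lparr>mem := (mem s)(a := \<lambda>i j. if i < dim_vec v \<and> j = 0 then to_ac (v $ i) else 0)\<rparr>"

fun load_update :: "'a::field update \<Rightarrow> 'a alg_closure state \<Rightarrow> 'a alg_closure state" where
  "load_update (Rank_One u v) s = load_vec 2 v (load_vec 1 u s)"
| "load_update (Add_Row i v) s = set_reg 0 i (load_vec 1 v s)"
| "load_update (Delete_Row i) s = set_reg 0 i s"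
| "load_update (Add_Col j v) s = set_reg 0 j (load_vec 1 v s)"
| "load_update (Delete_Col j) s = set_reg 0 j s"

text \<open>
  The final list contains one pair (number of steps, answer) for the initialisation (only in
  \<open>run\<close>), followed by one for each update.
\<close>

inductive run_updates ::
    "dyn_algorithm \<Rightarrow> (nat \<Rightarrow> 'a alg_closure) \<Rightarrow> 'a alg_closure state \<Rightarrow>
     'a::field update list \<Rightarrow> (nat \<times> nat) list \<Rightarrow> bool" for P \<omega> where
  "run_updates P \<omega> s [] []"
| "big_step \<omega> (program_for P u) (load_update u s) t s' \<Longrightarrow> run_updates P \<omega> s' us rs \<Longrightarrow>
     run_updates P \<omega> s (u # us) ((t, regs s' 0) # rs)"

inductive run ::
    "dyn_algorithm \<Rightarrow> (nat \<Rightarrow> 'a alg_closure) \<Rightarrow> nat \<Rightarrow> 'a::field mat \<Rightarrow>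
     'a update list \<Rightarrow> (nat \<times> nat) list \<Rightarrow> bool" for P \<omega> where
  "big_step \<omega> (prog_init P) (initial_state Q A) t s \<Longrightarrow> run_updates P \<omega> s us rs \<Longrightarrow>
     run P \<omega> Q A us ((t, regs s 0) # rs)"


section \<open>Field of computation, randomness, cost bounds\<close>

text \<open>
  \<open>computation_field N K S\<close>: the computation may be carried out over \<open>K\<close> with random elements drawn
  from \<open>S\<close>, when size \<open>N\<close> is wanted.  The base field is used if it is large enough, and otherwise an
  extension whose size is polynomial in \<open>N\<close>.  Since extension degrees are integers, \<open>N\<close> itself need
  not be attained, but a base field with fewer than \<open>N\<close> elements has an extension with between \<open>N\<close>
  and \<open>N\<^sup>2\<close> elements.
\<close>

definition computation_field ::
    "nat \<Rightarrow> 'a::field alg_closure set \<Rightarrow> 'a alg_closure set \<Rightarrow> bool" where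
  "computation_field N K S \<longleftrightarrow>
     subfield K (ring_of_type_algebra :: 'a alg_closure ring) \<and> range to_ac \<subseteq> K \<and>
     (if infinite (UNIV :: 'a set) \<or> N \<le> CARD('a) then K = range to_ac
      else finite K \<and> N \<le> card K \<and> card K \<le> N\<^sup>2) \<and>
     (if finite K then S = K else S \<subseteq> K \<and> finite S \<and> N \<le> card S)"

definition random_tapes :: "'k set \<Rightarrow> (nat \<Rightarrow> 'k) measure" where
  "random_tapes S = (\<Pi>\<^sub>M i\<in>UNIV. uniform_count_measure S)"

text \<open>
  The function \<open>s (log (s + 1))\<^sup>e\<close> for \<open>s = mn\<close>; an empty dimension counts as 1, since otherwise
  operations on an empty matrix would have to be free.
\<close>

definition soft_mn :: "nat \<Rightarrow> 'a mat \<Rightarrow> real" where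
  "soft_mn e B =
     (let s = real (max 1 (dim_row B) * max 1 (dim_col B)) in s * (log 2 (s + 1)) ^ e)"

text \<open>
  Every possible execution halts; the initialisation takes at most \<open>(m + n + 2)\<^sup>k\<close> steps and the
  update leading to the current matrix \<open>B\<close> at most \<open>C * soft_mn e B\<close> steps, whatever is drawn.
\<close>

definition within_cost_bounds ::
    "dyn_algorithm \<Rightarrow> nat \<Rightarrow> nat \<Rightarrow> nat \<Rightarrow> 'a alg_closure set \<Rightarrow> nat \<Rightarrow>
     'a::field mat \<Rightarrow> 'a update list \<Rightarrow> bool" where
  "within_cost_bounds P k C e S Q A us \<longleftrightarrow>
     (\<forall>\<omega> \<in> space (random_tapes S). \<exists>rs. run P \<omega> Q A us rs \<and>
        fst (rs ! 0) \<le> (dim_row A + dim_col A + 2) ^ k \<and>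
        (\<forall>i \<in> {1..length us}. real (fst (rs ! i)) \<le> real C * soft_mn e (history A us ! i)))"

definition prob_all_correct ::
    "dyn_algorithm \<Rightarrow> 'a alg_closure set \<Rightarrow> nat \<Rightarrow> 'a::field mat \<Rightarrow> 'a update list \<Rightarrow> real" where
  "prob_all_correct P S Q A us =
     measure (random_tapes S)
       {\<omega> \<in> space (random_tapes S).
          \<exists>rs. run P \<omega> Q A us rs \<and> map snd rs = map mat_rank (history A us)}"

end

theory Submission
  imports Defs
begin

text \<open>
  The algorithm is deterministic.  Together with \<open>A\<close> and its rank it maintains a generalised
  inverse \<open>X\<close>, that is, \<open>A X A = A\<close>.  For a rank one update \<open>A + u v\<^sup>T\<close> let \<open>a = X u\<close>,
  \<open>b\<^sup>T = v\<^sup>T X\<close>, \<open>e = u - A a\<close>, \<open>f\<^sup>T = v\<^sup>T - b\<^sup>T A\<close> and \<open>\<beta> = 1 + v\<^sup>T a\<close>.  Then \<open>e = 0\<close> iff \<open>u\<close> lies in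
  the column space of \<open>A\<close>, and \<open>f = 0\<close> iff \<open>v\<close> lies in its row space; the rank increases by one if
  \<open>e\<close> and \<open>f\<close> are both nonzero, decreases by one if \<open>e = 0\<close>, \<open>f = 0\<close> and \<open>\<beta> = 0\<close>, and is unchanged
  otherwise.  If \<open>e\<^sub>p \<noteq> 0\<close>, then row \<open>p\<close> of \<open>I - A X\<close> divided by \<open>e\<^sub>p\<close> is a vector \<open>g\<close> with
  \<open>g\<^sup>T A = 0\<close> and \<open>g\<^sup>T u = 1\<close>; dually, \<open>f\<^sub>q \<noteq> 0\<close> yields \<open>h\<close> with \<open>A h = 0\<close> and \<open>v\<^sup>T h = 1\<close>.  Put \<open>g = 0\<close>
  if \<open>e = 0\<close> and \<open>h = 0\<close> if \<open>f = 0\<close>, and let \<open>\<gamma> = 1 / \<beta>\<close> if \<open>e = 0\<close>, \<open>f = 0\<close>, \<open>\<beta> \<noteq> 0\<close>, and \<open>\<gamma> = 0\<close>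
  otherwise.  In all cases \<open>X - c g\<^sup>T - d b\<^sup>T\<close> with \<open>c = a - \<beta> h\<close> and \<open>d = h + \<gamma> c\<close> is a generalised
  inverse of \<open>A + u v\<^sup>T\<close>, and it is computed with \<open>O(m n)\<close> operations.  Adding a row inserts a
  zero row, which preserves rank and generalised inverse, and then performs a rank one update;
  deleting a row reverses this.  Since no random element is drawn, the base field is large enough.
\<close>

section \<open>Rank and rank factorisations\<close>

text \<open>The inner dimension is indexed by an arbitrary finite set of naturals: an index can then
  be added or eliminated without renumbering the others.\<close>

definition factors_through :: "nat \<Rightarrow> nat \<Rightarrow> (nat \<Rightarrow> nat \<Rightarrow> 'a::field) \<Rightarrow> nat \<Rightarrow> bool" where
  "factors_through m n A r \<longleftrightarrow> (\<exists>(I :: nat set) C R. finite I \<and> card I \<le> r \<and>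
     (\<forall>i<m. \<forall>j<n. A i j = (\<Sum>t\<in>I. C i t * R t j)))"

text \<open>Matrices are functions here because the arrays of the machine are; cells outside the
  \<open>m\<close> by \<open>n\<close> rectangle may hold anything.\<close>

definition fun_rank :: "nat \<Rightarrow> nat \<Rightarrow> (nat \<Rightarrow> nat \<Rightarrow> 'a::field) \<Rightarrow> nat" where
  "fun_rank m n A = mat_rank (mat m n (\<lambda>(i, j). A i j))"

lemma fun_rank_cong:
  "(\<And>i j. i < m \<Longrightarrow> j < n \<Longrightarrow> A i j = B i j) \<Longrightarrow> fun_rank m n A = fun_rank m n B"
proof -
  assume "\<And>i j. i < m \<Longrightarrow> j < n \<Longrightarrow> A i j = B i j"
  then have "mat m n (\<lambda>(i, j). A i j) = mat m n (\<lambda>(i, j). B i j)" by (intro eq_matI) auto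
  then show ?thesis by (simp add: fun_rank_def)
qed

lemma mat_rank_conv_fun_rank:
  "mat_rank A = fun_rank (dim_row A) (dim_col A) (\<lambda>i j. A $$ (i, j))"
proof -
  have "A = mat (dim_row A) (dim_col A) (\<lambda>(i, j). A $$ (i, j))" by (intro eq_matI) auto
  then show ?thesis by (simp add: fun_rank_def)
qed

context vec_space
begin

lemma in_span_imageI:
  fixes f :: "'b \<Rightarrow> 'a vec" and w :: "'a vec"
  assumes "finite I" and "\<And>t. t \<in> I \<Longrightarrow> f t \<in> carrier_vec n" and "w \<in> carrier_vec n"
    and "\<And>i. i < n \<Longrightarrow> w $ i = (\<Sum>t\<in>I. c t * f t $ i)"
  shows "w \<in> span (f ` I)"
proof -
  \<comment> \<open>The vectors \<open>f t\<close> need not be distinct, so the coefficients of each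
    fibre of \<open>f\<close> are added up.\<close>
  define a where "a x = (\<Sum>t\<in>{t \<in> I. f t = x}. c t)" for x
  have sub: "f ` I \<subseteq> carrier_vec n" using assms(2) by auto
  have "w = lincomb a (f ` I)"
  proof (rule eq_vecI)
    show dim: "dim_vec w = dim_vec (lincomb a (f ` I))"
      using lincomb_dim[OF _ sub] assms(1,3) by simp
    fix i assume "i < dim_vec (lincomb a (f ` I))"
    with dim assms(3) have i: "i < n" by simp
    have "(\<Sum>x\<in>f ` I. a x * x $ i) = (\<Sum>x\<in>f ` I. \<Sum>t\<in>{t \<in> I. f t = x}. c t * f t $ i)"
      by (intro sum.cong refl) (auto simp: a_def sum_distrib_right)
    also have "\<dots> = (\<Sum>t\<in>I. c t * f t $ i)"
      by (rule sum.image_gen[OF assms(1), symmetric])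
    finally show "w $ i = lincomb a (f ` I) $ i"
      using assms(4)[OF i] lincomb_index[OF i sub] by simp
  qed
  then show ?thesis unfolding span_def using assms(1) by auto
qed

text \<open>A column basis together with the coordinates of all columns is a factorisation.
  Conversely the columns lie in the span of at most \<open>r\<close> vectors, and the exchange lemma
  bounds every independent set of columns. This description of the rank is symmetric in rows and
  columns and turns rank bounds into manipulations of sums.\<close>

lemma rank_le_iff_factors:
  assumes A: "A \<in> carrier_mat n nc"
  shows "rank A \<le> r \<longleftrightarrow> factors_through n nc (\<lambda>i j. A $$ (i, j)) r"
proof -
  obtain S where "maximal S (\<lambda>T. T \<subseteq> set (cols A) \<and> lin_indpt T)"
    using maximal_exists_superset[of "set (cols A)" "\<lambda>T. T \<subseteq> set (cols A) \<and> lin_indpt T" "{}"]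
    by (auto simp: finite_lin_indpt2)
  note max = this and rank = rank_card_indpt[OF A this]
  have carr: "set (cols A) \<subseteq> carrier_vec n" using A by (metis carrier_matD(1) cols_dim)
  from max have S: "S \<subseteq> set (cols A)" "lin_indpt S" by (auto simp: maximal_def)
  then have fin: "finite S" using finite_subset by blast
  have Sc: "S \<subseteq> carrier_vec n" using S carr by auto
  show ?thesis
  proof
    assume r: "rank A \<le> r"
    have "x \<in> span S" if x: "x \<in> set (cols A)" for x
    proof (cases "x \<in> S")
      case False
      have "\<not> lin_indpt (S \<union> {x})"
      proof
        assume "lin_indpt (S \<union> {x})"
        with x S max have "S \<union> {x} = S" unfolding maximal_def by blast
        with False show False by auto
      qed
      then show ?thesis using lin_dep_iff_in_span[of S x] False S Sc x carr by auto
    qed (use Sc in \<open>auto intro: span_mem\<close>)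
    then have "\<forall>x. \<exists>a. x \<in> set (cols A) \<longrightarrow> lincomb a S = x"
      using finite_in_span[OF fin] Sc by (metis (no_types, lifting) module_vec_simps(3))
    then obtain a where a: "\<And>x. x \<in> set (cols A) \<Longrightarrow> lincomb (a x) S = x" by metis
    obtain h where h: "bij_betw h {0..<card S} S" using ex_bij_betw_nat_finite[OF fin] by blast
    have "A $$ (i, j) = (\<Sum>t\<in>{0..<card S}. h t $ i * a (col A j) (h t))" if "i < n" "j < nc" for i j
    proof -
      have x: "col A j \<in> set (cols A)" using that A by (auto simp: cols_def)
      have "A $$ (i, j) = lincomb (a (col A j)) S $ i" using that A a[OF x] by simp
      also have "\<dots> = (\<Sum>x\<in>S. x $ i * a (col A j) x)"
        using lincomb_index[OF that(1) Sc] by (simp add: mult.commute)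
      also have "\<dots> = (\<Sum>t\<in>{0..<card S}. h t $ i * a (col A j) (h t))"
        by (rule sum.reindex_bij_betw[OF h, symmetric])
      finally show ?thesis .
    qed
    then show "factors_through n nc (\<lambda>i j. A $$ (i, j)) r"
      unfolding factors_through_def using r rank
      by (intro exI[of _ "{0..<card S}"] exI[of _ "\<lambda>i t. h t $ i"]
          exI[of _ "\<lambda>t j. a (col A j) (h t)"]) auto
  next
    assume "factors_through n nc (\<lambda>i j. A $$ (i, j)) r"
    then obtain I :: "nat set" and C R where I: "finite I" "card I \<le> r"
      and AC: "\<And>i j. i < n \<Longrightarrow> j < nc \<Longrightarrow> A $$ (i, j) = (\<Sum>t\<in>I. C i t * R t j)"
      unfolding factors_through_def by blast
    define f where "f t = vec n (\<lambda>i. C i t)" for t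
    have fc: "f ` I \<subseteq> carrier_vec n" by (auto simp: f_def)
    have "S \<subseteq> span (f ` I)"
    proof
      fix x assume "x \<in> S"
      with S A obtain j where j: "j < nc" "x = col A j" by (auto simp: cols_def)
      show "x \<in> span (f ` I)"
        by (rule in_span_imageI[where c = "\<lambda>t. R t j"])
          (use j A I AC in \<open>auto simp: f_def mult.commute\<close>)
    qed
    then have "int (card S) \<le> int (card (f ` I))"
      using replacement[OF fin _ _ S(2), of "f ` I"] I fc by force
    then show "rank A \<le> r" using rank I card_image_le[OF I(1), of f] by linarith
  qed
qed

end

section \<open>Rank under multiplication, transposition and rank one updates\<close>

lemma fun_rank_le_iff: "fun_rank m n A \<le> r \<longleftrightarrow> factors_through m n A r"
proof -
  have "mat m n (\<lambda>(i, j). A i j) \<in> carrier_mat m n" by simp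
  from vec_space.rank_le_iff_factors[OF this, of r] show ?thesis
    by (simp add: fun_rank_def mat_rank_def factors_through_def)
qed

lemma fun_rank_leD:
  assumes "fun_rank m n A \<le> r"
  obtains I :: "nat set" and C R where "finite I" "card I \<le> r"
    "\<And>i j. i < m \<Longrightarrow> j < n \<Longrightarrow> A i j = (\<Sum>t\<in>I. C i t * R t j)"
  using assms unfolding fun_rank_le_iff factors_through_def by blast

lemma fun_rank_leI:
  fixes I :: "nat set"
  assumes "finite I" "card I \<le> r" "\<And>i j. i < m \<Longrightarrow> j < n \<Longrightarrow> A i j = (\<Sum>t\<in>I. C i t * R t j)"
  shows "fun_rank m n A \<le> r"
  using assms unfolding fun_rank_le_iff factors_through_def by blast

text \<open>A factorisation \<open>C R\<close> of \<open>A\<close> yields the factorisation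
  \<open>(L C) R\<close> of \<open>L A\<close>.\<close>

lemma fun_rank_left_mult_le:
  assumes "\<And>i j. i < m \<Longrightarrow> j < n \<Longrightarrow> B i j = (\<Sum>k<p. L i k * A k j)"
  shows "fun_rank m n B \<le> fun_rank p n A"
proof -
  obtain I C R where I: "finite (I :: nat set)" "card I \<le> fun_rank p n A"
    and A: "\<And>i j. i < p \<Longrightarrow> j < n \<Longrightarrow> A i j = (\<Sum>t\<in>I. C i t * R t j)"
    using fun_rank_leD[OF order_refl] by blast
  show ?thesis
  proof (rule fun_rank_leI[OF I])
    fix i j assume ij: "i < m" "j < n"
    have "B i j = (\<Sum>k<p. L i k * (\<Sum>t\<in>I. C k t * R t j))"
      unfolding assms[OF ij] using A ij by (intro sum.cong) auto
    also have "\<dots> = (\<Sum>t\<in>I. (\<Sum>k<p. L i k * C k t) * R t j)"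
      by (simp add: sum_distrib_left sum_distrib_right mult.assoc) (rule sum.swap)
    finally show "B i j = (\<Sum>t\<in>I. (\<Sum>k<p. L i k * C k t) * R t j)" .
  qed
qed

lemma fun_rank_transpose: "fun_rank n m (\<lambda>i j. A j i) = fun_rank m n A"
proof -
  have "fun_rank n m (\<lambda>i j. A j i) \<le> fun_rank m n A" for m n and A :: "nat \<Rightarrow> nat \<Rightarrow> 'a"
  proof -
    obtain I C R where I: "finite (I :: nat set)" "card I \<le> fun_rank m n A"
      and A: "\<And>i j. i < m \<Longrightarrow> j < n \<Longrightarrow> A i j = (\<Sum>t\<in>I. C i t * R t j)"
      using fun_rank_leD[OF order_refl] by blast
    show ?thesis
      by (rule fun_rank_leI[OF I, where C = "\<lambda>j t. R t j" and R = "\<lambda>t i. C i t"])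
        (simp add: A mult.commute)
  qed
  from this[of n m A] this[of m n "\<lambda>i j. A j i"] show ?thesis by simp
qed

text \<open>Since \<open>v^T = w^T A\<close>, the updated matrix is \<open>(I + u w^T) A\<close>,
  and \<open>I + u w^T\<close> is invertible because \<open>1 + w^T u\<close> is nonzero.\<close>

lemma fun_rank_rank_one_same:
  assumes v: "\<And>j. j < n \<Longrightarrow> v j = (\<Sum>k<m. w k * A k j)"
    and w: "(\<Sum>k<m. w k * u k) \<noteq> - 1"
  shows "fun_rank m n (\<lambda>i j. A i j + u i * v j) = fun_rank m n A"
proof (rule antisym)
  show "fun_rank m n (\<lambda>i j. A i j + u i * v j) \<le> fun_rank m n A"
    by (rule fun_rank_left_mult_le[where L = "\<lambda>i k. (if k = i then 1 else 0) + u i * w k"])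
      (simp add: v distrib_right sum.distrib sum_distrib_left mult.assoc if_distrib[of "\<lambda>x. x * _"]
        cong: if_cong)
  define s where "s = (\<Sum>k<m. w k * u k)"
  have s: "1 + s \<noteq> 0" using w by (simp add: s_def add_eq_0_iff)
  show "fun_rank m n A \<le> fun_rank m n (\<lambda>i j. A i j + u i * v j)"
  \<comment> \<open>This \<open>L\<close> is the Sherman-Morrison inverse of
    \<open>I + u w^T\<close>.\<close>
  proof (rule fun_rank_left_mult_le[where L = "\<lambda>i k. (if k = i then 1 else 0) - u i / (1 + s) * w k"])
    fix i j assume ij: "i < m" "j < n"
    have "(\<Sum>k<m. ((if k = i then 1 else 0) - u i / (1 + s) * w k) * (A k j + u k * v j))
       = (\<Sum>k<m. (if k = i then A k j + u k * v j else 0)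
            - (u i / (1 + s) * (w k * A k j) + u i / (1 + s) * v j * (w k * u k)))"
      by (intro sum.cong refl) (simp add: algebra_simps add_divide_distrib)
    also have "\<dots> = (A i j + u i * v j)
        - (\<Sum>k<m. u i / (1 + s) * (w k * A k j) + u i / (1 + s) * v j * (w k * u k))"
      using ij by (simp add: sum_subtractf)
    also have "\<dots> = (A i j + u i * v j) - (u i / (1 + s) * v j + u i / (1 + s) * v j * s)"
      unfolding sum.distrib sum_distrib_left[symmetric] v[OF ij(2), symmetric] s_def[symmetric] by simp
    also have "u i / (1 + s) * v j + u i / (1 + s) * v j * s = u i / (1 + s) * (1 + s) * v j"
      by (simp only: distrib_left distrib_right mult_1_left mult_1_right mult_ac)
    also have "\<dots> = u i * v j" using s by simp
    finally show "A i j = (\<Sum>k<m. ((if k = i then 1 else 0) - u i / (1 + s) * w k) * (A k j + u k * v j))"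
      by simp
  qed
qed

text \<open>\<open>g\<close> and \<open>h\<close> witness that \<open>u\<close> lies outside the
  column space and \<open>v\<close> outside the row space. One additional index gives the upper
  bound; for the lower bound an index is removed from a factorisation of the updated matrix to
  obtain one of \<open>A\<close>.\<close>

lemma fun_rank_rank_one_incr:
  assumes gA: "\<And>j. j < n \<Longrightarrow> (\<Sum>k<m. g k * A k j) = 0" and gu: "(\<Sum>k<m. g k * u k) = 1"
    and hA: "\<And>i. i < m \<Longrightarrow> (\<Sum>l<n. A i l * h l) = 0" and hv: "(\<Sum>l<n. v l * h l) = 1"
  shows "fun_rank m n (\<lambda>i j. A i j + u i * v j) = Suc (fun_rank m n A)"
proof (rule antisym)
  let ?B = "\<lambda>i j. A i j + u i * v j"
  obtain I C R where I: "finite (I :: nat set)" "card I \<le> fun_rank m n A"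
    and A: "\<And>i j. i < m \<Longrightarrow> j < n \<Longrightarrow> A i j = (\<Sum>t\<in>I. C i t * R t j)"
    using fun_rank_leD[OF order_refl] by blast
  obtain z where z: "z \<notin> I" using I(1) ex_new_if_finite infinite_UNIV_nat by blast
  show "fun_rank m n ?B \<le> Suc (fun_rank m n A)"
  proof (rule fun_rank_leI[where I = "insert z I" and C = "\<lambda>i t. if t = z then u i else C i t"
        and R = "\<lambda>t j. if t = z then v j else R t j"])
    fix i j assume ij: "i < m" "j < n"
    have "(\<Sum>t\<in>I. (if t = z then u i else C i t) * (if t = z then v j else R t j)) = A i j"
      unfolding A[OF ij] using z by (intro sum.cong) auto
    then show "?B i j = (\<Sum>t\<in>insert z I. (if t = z then u i else C i t) * (if t = z then v j else R t j))"
      by (subst sum.insert[OF I(1) z]) (simp only: add.commute if_True refl)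
  qed (use I z in auto)
next
  let ?B = "\<lambda>i j. A i j + u i * v j"
  obtain I C R where I: "finite (I :: nat set)" "card I \<le> fun_rank m n ?B"
    and B: "\<And>i j. i < m \<Longrightarrow> j < n \<Longrightarrow> ?B i j = (\<Sum>t\<in>I. C i t * R t j)"
    by (rule fun_rank_leD[OF order_refl[of "fun_rank m n ?B"]]) (rule that)
  \<comment> \<open>For the updated matrix \<open>B = C R\<close> these are \<open>R h\<close> and
    \<open>g^T C\<close>. From \<open>B h = u\<close> and \<open>g^T B = v^T\<close> follow
    \<open>C p = u\<close>, \<open>q^T R = v^T\<close> and \<open>q^T p = 1\<close>, so
    \<open>A = (C - u q^T) R\<close>.\<close>
  define p where "p t = (\<Sum>l<n. R t l * h l)" for t
  define q where "q t = (\<Sum>k<m. g k * C k t)" for t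
  have Cp: "(\<Sum>t\<in>I. C i t * p t) = u i" if i: "i < m" for i
  proof -
    have "(\<Sum>t\<in>I. C i t * p t) = (\<Sum>l<n. (\<Sum>t\<in>I. C i t * R t l) * h l)"
      by (simp add: p_def sum_distrib_left sum_distrib_right mult.assoc) (rule sum.swap)
    also have "\<dots> = (\<Sum>l<n. ?B i l * h l)" using B i by (intro sum.cong) auto
    also have "\<dots> = (\<Sum>l<n. A i l * h l) + u i * (\<Sum>l<n. v l * h l)"
      by (simp add: distrib_right sum.distrib sum_distrib_left mult.assoc)
    finally show ?thesis using hA[OF i] hv by simp
  qed
  have qR: "(\<Sum>t\<in>I. q t * R t j) = v j" if j: "j < n" for j
  proof -
    have "(\<Sum>t\<in>I. q t * R t j) = (\<Sum>k<m. g k * (\<Sum>t\<in>I. C k t * R t j))"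
      by (simp add: q_def sum_distrib_left sum_distrib_right mult.assoc) (rule sum.swap)
    also have "\<dots> = (\<Sum>k<m. g k * ?B k j)" using B j by (intro sum.cong) auto
    also have "\<dots> = (\<Sum>k<m. g k * A k j) + (\<Sum>k<m. g k * u k) * v j"
      by (simp add: distrib_left sum.distrib sum_distrib_right mult.assoc)
    finally show ?thesis using gA[OF j] gu by simp
  qed
  have qp: "(\<Sum>t\<in>I. q t * p t) = 1"
  proof -
    have "(\<Sum>t\<in>I. q t * p t) = (\<Sum>k<m. g k * (\<Sum>t\<in>I. C k t * p t))"
      by (simp add: q_def sum_distrib_left sum_distrib_right mult.assoc) (rule sum.swap)
    also have "\<dots> = (\<Sum>k<m. g k * u k)" using Cp by (intro sum.cong) auto
    finally show ?thesis using gu by simp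
  qed
  then obtain s where s: "s \<in> I" "p s \<noteq> 0"
    by (metis (no_types, lifting) mult_zero_right sum.neutral zero_neq_one)
  \<comment> \<open>\<open>C - u q\<^sup>T\<close> annihilates \<open>p\<close>, so its column \<open>s\<close> can be eliminated.\<close>
  define D where "D i t = C i t - u i * q t" for i t
  have Dp: "(\<Sum>t\<in>I. D i t * p t) = 0" if "i < m" for i
    using Cp[OF that] qp
    by (simp add: D_def left_diff_distrib sum_subtractf mult.assoc flip: sum_distrib_left)
  have "fun_rank m n A \<le> card (I - {s})"
  proof (rule fun_rank_leI[where I = "I - {s}" and C = D and R = "\<lambda>t j. R t j - p t / p s * R s j"])
    fix i j assume ij: "i < m" "j < n"
    have "(\<Sum>t\<in>I - {s}. D i t * (R t j - p t / p s * R s j))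
        = (\<Sum>t\<in>I. D i t * (R t j - p t / p s * R s j))"
      unfolding sum.remove[OF I(1) s(1), of "\<lambda>t. D i t * (R t j - p t / p s * R s j)"]
      using s by simp
    also have "\<dots> = (\<Sum>t\<in>I. D i t * R t j) - (\<Sum>t\<in>I. D i t * p t) * R s j / p s"
      by (simp add: right_diff_distrib sum_subtractf sum_distrib_right sum_divide_distrib mult.assoc)
    also have "\<dots> = (\<Sum>t\<in>I. C i t * R t j) - u i * (\<Sum>t\<in>I. q t * R t j)"
      using Dp[OF ij(1)] by (simp add: D_def left_diff_distrib sum_subtractf mult.assoc sum_distrib_left)
    finally show "A i j = (\<Sum>t\<in>I - {s}. D i t * (R t j - p t / p s * R s j))"
      using qR[OF ij(2)] B[OF ij, symmetric] by simp
  qed (use I in auto)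
  moreover have "card I > 0" using s I by (auto simp: card_gt_0_iff)
  ultimately show "Suc (fun_rank m n A) \<le> fun_rank m n ?B" using s I by simp
qed


section \<open>Generalised inverses\<close>

text \<open>\<open>Y\<close> is the transpose of a generalised inverse \<open>X\<close> of \<open>A\<close>, that is, \<open>A X A = A\<close>.\<close>

definition ginv :: "nat \<Rightarrow> nat \<Rightarrow> (nat \<Rightarrow> nat \<Rightarrow> 'a::field) \<Rightarrow> (nat \<Rightarrow> nat \<Rightarrow> 'a) \<Rightarrow> bool" where
  "ginv m n A Y \<longleftrightarrow> (\<forall>i<m. \<forall>j<n. (\<Sum>k<m. (\<Sum>l<n. A i l * Y k l) * A k j) = A i j)"

lemma ginv_cong:
  assumes "\<And>i j. i < m \<Longrightarrow> j < n \<Longrightarrow> A i j = A' i j" "\<And>i j. i < m \<Longrightarrow> j < n \<Longrightarrow> Y i j = Y' i j"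
  shows "ginv m n A Y \<longleftrightarrow> ginv m n A' Y'"
  unfolding ginv_def using assms by simp

text \<open>The equation \<open>A X A = A\<close> is transposed as a whole; facts about rows thereby
  yield facts about columns.\<close>

lemma ginv_transpose: "ginv n m (\<lambda>i j. A j i) (\<lambda>i j. Y j i) \<longleftrightarrow> ginv m n A Y"
proof -
  have "(\<Sum>k<n. (\<Sum>l<m. A l i * Y l k) * A j k) = (\<Sum>k<m. (\<Sum>l<n. A j l * Y k l) * A k i)" for i j
    unfolding sum_distrib_right by (subst sum.swap) (simp add: mult_ac)
  then show ?thesis unfolding ginv_def by auto
qed

text \<open>The assumptions are what the program establishes for its arrays and registers.
  \<open>e0\<close> is both the flag for \<open>e = 0\<close> and the divisor in \<open>g\<close>;
  if it is 0, \<open>p\<close> is unconstrained and division by zero makes \<open>g\<close> vanish.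
  The same holds for \<open>f0\<close>, \<open>q\<close> and \<open>h\<close>. Likewise \<gamma> is
  0 when \<beta> is.\<close>

locale rank_one_step =
  fixes m n :: nat and A Y :: "nat \<Rightarrow> nat \<Rightarrow> 'a::field" and u v a b e f g h :: "nat \<Rightarrow> 'a"
    and \<beta> \<gamma> e0 f0 :: 'a and p q :: nat
  assumes ginv: "ginv m n A Y"
    and a: "\<And>j. j < n \<Longrightarrow> a j = (\<Sum>i<m. Y i j * u i)"
    and b: "\<And>i. i < m \<Longrightarrow> b i = (\<Sum>j<n. Y i j * v j)"
    and e: "\<And>i. i < m \<Longrightarrow> e i = u i - (\<Sum>j<n. A i j * a j)"
    and f: "\<And>j. j < n \<Longrightarrow> f j = v j - (\<Sum>i<m. A i j * b i)"
    and \<beta>: "\<beta> = 1 + (\<Sum>j<n. v j * a j)"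
    and e0: "e0 = 0 \<and> (\<forall>i<m. e i = 0) \<or> p < m \<and> e0 = e p \<and> e0 \<noteq> 0"
    and f0: "f0 = 0 \<and> (\<forall>j<n. f j = 0) \<or> q < n \<and> f0 = f q \<and> f0 \<noteq> 0"
    and g: "\<And>k. k < m \<Longrightarrow> g k = ((if k = p then 1 else 0) - (\<Sum>j<n. A p j * Y k j)) / e0"
    and h: "\<And>j. j < n \<Longrightarrow> h j = ((if j = q then 1 else 0) - (\<Sum>k<m. Y k j * A k q)) / f0"
    and \<gamma>: "\<gamma> = (if e0 = 0 \<and> f0 = 0 then 1 / \<beta> else 0)"
begin

text \<open>Transposition exchanges \<open>u\<close> with \<open>v\<close>, \<open>a\<close> with
  \<open>b\<close>, \<open>e\<close> with \<open>f\<close> and \<open>g\<close> with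
  \<open>h\<close>; \<beta> is preserved because \<open>v^T X u\<close> can be summed in either
  order.\<close>

lemma transposed: "rank_one_step n m (\<lambda>i j. A j i) (\<lambda>i j. Y j i) v u b a f e h g \<beta> \<gamma> f0 e0 q p"
proof
  show "\<beta> = 1 + (\<Sum>j<m. u j * b j)"
  proof -
    have "(\<Sum>j<m. u j * b j) = (\<Sum>k<m. \<Sum>l<n. u k * (Y k l * v l))"
      by (simp add: b sum_distrib_left)
    also have "\<dots> = (\<Sum>l<n. \<Sum>k<m. u k * (Y k l * v l))" by (rule sum.swap)
    also have "\<dots> = (\<Sum>j<n. v j * a j)" by (simp add: a sum_distrib_left mult_ac)
    finally show ?thesis by (simp add: \<beta>)
  qed
  show "\<gamma> = (if f0 = 0 \<and> e0 = 0 then 1 / \<beta> else 0)" using \<gamma> by (simp add: conj_commute)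
qed (fact a b e f e0 f0 ginv_transpose[THEN iffD2, OF ginv] | simp add: g h mult.commute)+

lemma AYA: "i < m \<Longrightarrow> j < n \<Longrightarrow> (\<Sum>k<m. (\<Sum>l<n. A i l * Y k l) * A k j) = A i j"
  using ginv by (simp add: ginv_def)

text \<open>This is \<open>A X u = A a\<close>, which is \<open>u - e\<close> by the choice of
  \<open>e\<close>.\<close>

lemma AYu: "i < m \<Longrightarrow> (\<Sum>k<m. (\<Sum>l<n. A i l * Y k l) * u k) = u i - e i"
proof -
  assume i: "i < m"
  have "(\<Sum>k<m. (\<Sum>l<n. A i l * Y k l) * u k) = (\<Sum>l<n. A i l * (\<Sum>k<m. Y k l * u k))"
    by (simp add: sum_distrib_left sum_distrib_right mult.assoc) (rule sum.swap)
  then show ?thesis using i by (simp add: e a)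
qed

lemma Aa: "i < m \<Longrightarrow> (\<Sum>l<n. A i l * a l) = u i - e i"
  by (simp add: e)

lemma va: "(\<Sum>l<n. v l * a l) = \<beta> - 1"
  by (simp add: \<beta>)

text \<open>\<open>g^T\<close> is row \<open>p\<close> of \<open>I - A X\<close> divided by
  \<open>e0\<close>, and \<open>(I - A X) A = 0\<close>.\<close>

lemma gA: assumes j: "j < n" shows "(\<Sum>k<m. g k * A k j) = 0"
proof (cases "e0 = 0")
  case True
  then show ?thesis by (simp add: g)
next
  case False
  then have p: "p < m" using e0 by auto
  have "(\<Sum>k<m. g k * A k j)
      = (\<Sum>k<m. ((if k = p then A k j else 0) - (\<Sum>l<n. A p l * Y k l) * A k j) / e0)"
    by (intro sum.cong refl) (simp add: g left_diff_distrib)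
  also have "\<dots> = 0"
    using p AYA[OF p j] by (simp add: sum_subtractf flip: sum_divide_distrib)
  finally show ?thesis .
qed

text \<open>Row \<open>p\<close> of \<open>I - A X\<close> times \<open>u\<close> is
  \<open>e p\<close>, and the division by \<open>e0\<close> normalises it to 1.\<close>

lemma gu: "(\<Sum>k<m. g k * u k) = (if e0 = 0 then 0 else 1)"
proof (cases "e0 = 0")
  case True
  then show ?thesis by (simp add: g)
next
  case False
  then have p: "p < m" "e p = e0" using e0 by auto
  have "(\<Sum>k<m. g k * u k)
      = (\<Sum>k<m. ((if k = p then u k else 0) - (\<Sum>l<n. A p l * Y k l) * u k) / e0)"
    by (intro sum.cong refl) (simp add: g left_diff_distrib)
  also have "\<dots> = 1"
    using False p AYu[OF p(1)] by (simp add: sum_subtractf flip: sum_divide_distrib)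
  finally show ?thesis using False by simp
qed

lemma e_eq_0: "e0 = 0 \<Longrightarrow> i < m \<Longrightarrow> e i = 0"
  using e0 by auto

end

section \<open>The transposed identities, the new generalised inverse and the change of rank\<close>

context rank_one_step
begin

interpretation T: rank_one_step n m "\<lambda>i j. A j i" "\<lambda>i j. Y j i" v u b a f e h g \<beta> \<gamma> f0 e0 q p
  by (rule transposed)

lemma bA: "j < n \<Longrightarrow> (\<Sum>k<m. b k * A k j) = v j - f j"
  using T.Aa[of j] by (simp add: mult.commute)

lemma bu: "(\<Sum>k<m. b k * u k) = \<beta> - 1"
  using T.va by (simp add: mult.commute)

lemma Ah: "i < m \<Longrightarrow> (\<Sum>l<n. A i l * h l) = 0"
  using T.gA[of i] by (simp add: mult.commute)

lemma vh: "(\<Sum>l<n. v l * h l) = (if f0 = 0 then 0 else 1)"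
  using T.gu by (simp add: mult.commute)

text \<open>Row \<open>i\<close> of the updated matrix times the new inverse is a combination of row
  \<open>i\<close> of \<open>A X\<close> with \<open>b\<close> and \<open>g\<close>. Multiplying it
  by the updated matrix then needs only the products of these three vectors with \<open>A\<close>
  and \<open>u\<close>.\<close>

lemma ginv_update:
  "ginv m n (\<lambda>i j. A i j + u i * v j)
     (\<lambda>i j. Y i j - (a j - \<beta> * h j) * g i - (h j + \<gamma> * (a j - \<beta> * h j)) * b i)"
  unfolding ginv_def
proof (intro allI impI)
  fix i j assume i: "i < m" and j: "j < n"
  define P where "P k = (\<Sum>l<n. A i l * Y k l)" for k
  \<comment> \<open>With \<open>c = a - \<beta> h\<close> and \<open>d = h + \<gamma> c\<close>,
    these are \<open>D = v^T h\<close> and \<open>vc = v^T c\<close>, while \<open>y\<close> and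
    \<open>z\<close> are the entries at \<open>i\<close> of the updated matrix times
    \<open>c\<close> and \<open>d\<close>.\<close>
  define D where "D = (if f0 = 0 then 0 else 1 :: 'a)"
  define vc where "vc = \<beta> - 1 - \<beta> * D"
  define y where "y = u i - e i + u i * vc"
  define z where "z = \<gamma> * (u i - e i) + u i * (D + \<gamma> * vc)"
  let ?N = "\<lambda>k. \<Sum>l<n. (A i l + u i * v l) *
      (Y k l - (a l - \<beta> * h l) * g k - (h l + \<gamma> * (a l - \<beta> * h l)) * b k)"
  have N: "?N k = P k + u i * b k - y * g k - z * b k" if k: "k < m" for k
  proof -
    have "?N k = (\<Sum>l<n. A i l * Y k l + u i * (Y k l * v l)
        - (g k + \<gamma> * b k) * (A i l * a l)
        - u i * (g k + \<gamma> * b k) * (v l * a l)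
        - (b k - \<beta> * (g k + \<gamma> * b k)) * (A i l * h l)
        - u i * (b k - \<beta> * (g k + \<gamma> * b k)) * (v l * h l))"
      by (intro sum.cong refl) (simp add: algebra_simps)
    also have "\<dots> = P k + u i * b k - (g k + \<gamma> * b k) * (u i - e i) - u i * (g k + \<gamma> * b k) * (\<beta> - 1)
        - u i * (b k - \<beta> * (g k + \<gamma> * b k)) * D"
      unfolding sum.distrib sum_subtractf sum_distrib_left[symmetric] Aa[OF i] va Ah[OF i] vh
      using k by (simp add: P_def b D_def)
    also have "\<dots> = P k + u i * b k - y * g k - z * b k"
      by (simp add: y_def z_def vc_def algebra_simps)
    finally show ?thesis .
  qed
  have "(\<Sum>k<m. ?N k * (A k j + u k * v j))
      = (\<Sum>k<m. P k * A k j + v j * (P k * u k) + (u i - z) * (b k * A k j)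
          + (u i - z) * v j * (b k * u k) - y * (g k * A k j) - y * v j * (g k * u k))"
    by (intro sum.cong refl) (simp only: N lessThan_iff, simp add: algebra_simps)
  also have "\<dots> = A i j + v j * (u i - e i) + (u i - z) * (v j - f j) + (u i - z) * v j * (\<beta> - 1)
      - y * v j * (if e0 = 0 then 0 else 1)"
    unfolding sum.distrib sum_subtractf sum_distrib_left[symmetric] bA[OF j] bu gA[OF j] gu
    using i j by (simp add: P_def AYA AYu)
  \<comment> \<open>If \<open>e0\<close> and \<open>f0\<close> are 0, then
    \<open>z = \<gamma> \<beta> (u i)\<close>, so \<open>(u i - z) \<beta> = 0\<close> whether or
    not \<beta> is 0. If \<open>f0\<close> is nonzero, then \<open>z = u i\<close>, as
    \<open>D = 1\<close> and \<gamma> is 0. In the remaining case \<open>z = 0\<close> and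
    \<open>y = \<beta> (u i) - e i\<close>.\<close>
  also have "\<dots> = A i j + u i * v j"
  proof (cases "e0 = 0")
    case e0: True
    then have e: "e i = 0" using e_eq_0 i by simp
    show ?thesis
    proof (cases "f0 = 0")
      case True
      then have "f j = 0" using T.e_eq_0 j by simp
      then show ?thesis using True e0 e by (cases "\<beta> = 0")
          (simp_all add: D_def vc_def y_def z_def \<gamma> field_simps)
    next
      case False
      then show ?thesis using e0 e by (simp add: D_def vc_def y_def z_def \<gamma> algebra_simps)
    qed
  next
    case e0: False
    show ?thesis
    proof (cases "f0 = 0")
      case True
      then have "f j = 0" using T.e_eq_0 j by simp
      then show ?thesis using True e0 by (simp add: D_def vc_def y_def z_def \<gamma> algebra_simps)
    next
      case False
      then show ?thesis using e0 by (simp add: D_def vc_def y_def z_def \<gamma> algebra_simps)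
    qed
  qed
  finally show "(\<Sum>k<m. ?N k * (A k j + u k * v j)) = A i j + u i * v j" .
qed

text \<open>If \<open>e = 0\<close>, then \<open>w = b\<close> satisfies \<open>w^T A = v^T\<close>
  and \<open>w^T u = \<beta> - 1\<close>, which is not -1. Otherwise subtracting
  \<open>(\<beta> - 1) g\<close> keeps the first equation, as \<open>g^T A = 0\<close>, and makes
  \<open>w^T u = 0\<close>.\<close>

lemma rank_same:
  assumes f: "f0 = 0" and e: "e0 \<noteq> 0 \<or> \<beta> \<noteq> 0"
  shows "fun_rank m n (\<lambda>i j. A i j + u i * v j) = fun_rank m n A"
proof (cases "e0 = 0")
  case True
  show ?thesis
    by (rule fun_rank_rank_one_same[where w = b]) (use True e f bA bu T.e_eq_0 in auto)
next
  case False
  have "(\<Sum>k<m. (b k - (\<beta> - 1) * g k) * u k) = (\<Sum>k<m. b k * u k) - (\<beta> - 1) * (\<Sum>k<m. g k * u k)"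
    by (simp add: left_diff_distrib sum_subtractf sum_distrib_left mult.assoc)
  then have w: "(\<Sum>k<m. (b k - (\<beta> - 1) * g k) * u k) = 0" using False by (simp add: bu gu)
  show ?thesis
  proof (rule fun_rank_rank_one_same[where w = "\<lambda>k. b k - (\<beta> - 1) * g k"])
    fix j assume j: "j < n"
    have "(\<Sum>k<m. (b k - (\<beta> - 1) * g k) * A k j)
        = (\<Sum>k<m. b k * A k j) - (\<beta> - 1) * (\<Sum>k<m. g k * A k j)"
      by (simp add: left_diff_distrib sum_subtractf sum_distrib_left mult.assoc)
    then show "v j = (\<Sum>k<m. (b k - (\<beta> - 1) * g k) * A k j)"
      using j T.e_eq_0[OF f j] by (simp add: bA gA)
  qed (simp add: w)
qed

lemma rank_incr:
  assumes "e0 \<noteq> 0" "f0 \<noteq> 0"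
  shows "fun_rank m n (\<lambda>i j. A i j + u i * v j) = Suc (fun_rank m n A)"
  by (rule fun_rank_rank_one_incr[where g = g and h = h]) (use assms gA gu Ah vh in auto)

text \<open>Here \<open>A\<close> arises from the updated matrix by adding \<open>- u v\<^sup>T\<close>, which increases the rank.\<close>

lemma rank_decr:
  assumes e: "e0 = 0" and f: "f0 = 0" and \<beta>0: "\<beta> = 0"
  shows "fun_rank m n A = Suc (fun_rank m n (\<lambda>i j. A i j + u i * v j))"
proof -
  have "fun_rank m n (\<lambda>i j. (A i j + u i * v j) + (- u i) * v j)
      = Suc (fun_rank m n (\<lambda>i j. A i j + u i * v j))"
  \<comment> \<open>Here \<open>b^T A = v^T\<close>, \<open>A a = u\<close> and
    \<open>b^T u = v^T a = -1\<close>; so \<open>b\<close> and \<open>- a\<close> annihilate the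
    updated matrix from the left and from the right.\<close>
  proof (rule fun_rank_rank_one_incr[where g = b and h = "\<lambda>l. - a l"])
    fix j assume j: "j < n"
    have "(\<Sum>k<m. b k * (A k j + u k * v j)) = (\<Sum>k<m. b k * A k j) + (\<Sum>k<m. b k * u k) * v j"
      by (simp add: distrib_left sum.distrib sum_distrib_right mult.assoc)
    then show "(\<Sum>k<m. b k * (A k j + u k * v j)) = 0"
      using T.e_eq_0[OF f j] \<beta>0 j by (simp add: bA bu)
  next
    fix i assume i: "i < m"
    have "(\<Sum>l<n. (A i l + u i * v l) * - a l) = - (\<Sum>l<n. A i l * a l) - u i * (\<Sum>l<n. v l * a l)"
      by (simp add: distrib_right sum.distrib sum_distrib_left mult.assoc sum_subtractf sum_negf)
    then show "(\<Sum>l<n. (A i l + u i * v l) * - a l) = 0"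
      using e_eq_0[OF e i] \<beta>0 i by (simp add: Aa va)
  qed (use \<beta>0 in \<open>simp_all add: bu va sum_negf\<close>)
  then show ?thesis by simp
qed

end

context rank_one_step
begin

interpretation T: rank_one_step n m "\<lambda>i j. A j i" "\<lambda>i j. Y j i" v u b a f e h g \<beta> \<gamma> f0 e0 q p
  by (rule transposed)

text \<open>\<open>rank_same\<close>, \<open>rank_incr\<close> and \<open>rank_decr\<close> leave
  only the case \<open>e = 0\<close> with \<open>f\<close> nonzero, which is
  \<open>rank_same\<close> for the transposed matrices.\<close>

lemma rank_update:
  "fun_rank m n (\<lambda>i j. A i j + u i * v j) =
     (if e0 = 0 then (if f0 = 0 \<and> \<beta> = 0 then fun_rank m n A - 1 else fun_rank m n A)
      else (if f0 = 0 then fun_rank m n A else fun_rank m n A + 1))"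
proof -
  have "fun_rank m n (\<lambda>i j. A i j + u i * v j) = fun_rank m n A" if "e0 = 0" "f0 \<noteq> 0"
    using T.rank_same[OF that(1)] that(2) fun_rank_transpose[of n m A]
      fun_rank_transpose[of n m "\<lambda>i j. A i j + u i * v j"] by (simp add: mult.commute)
  then show ?thesis using rank_same rank_incr rank_decr by auto
qed

end

section \<open>Inserting a zero row\<close>

text \<open>The increasing enumeration of all naturals except \<open>p\<close>: it sends positions
  before an insertion at \<open>p\<close> to those after it, and positions after a deletion to those
  before it.\<close>

definition skip :: "nat \<Rightarrow> nat \<Rightarrow> nat" where
  "skip p i = (if i < p then i else Suc i)"

lemma sum_skip: "p \<le> m \<Longrightarrow> (\<Sum>k<Suc m. F k) = F p + (\<Sum>k<m. F (skip p k))"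
proof -
  assume p: "p \<le> m"
  have "bij_betw (skip p) {..<m} ({..<Suc m} - {p})"
    by (rule bij_betw_byWitness[where f' = "\<lambda>i. if i < p then i else i - 1"])
      (use p in \<open>auto simp: skip_def\<close>)
  then have "(\<Sum>k<m. F (skip p k)) = sum F ({..<Suc m} - {p})" by (rule sum.reindex_bij_betw)
  then show ?thesis using p by (simp add: sum.remove[of _ p] del: sum.lessThan_Suc)
qed

lemma skip_cases:
  assumes "i < Suc m" "p \<le> m"
  obtains "i = p" | k where "k < m" "i = skip p k"
proof (cases "i = p")
  case False
  then show ?thesis
    using that(2)[of i] that(2)[of "i - 1"] assms by (cases "i < p") (auto simp: skip_def)
qed (use that in auto)

lemma skip_less: "i < m \<Longrightarrow> skip p i < Suc m" and skip_neq: "skip p i \<noteq> p"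
  by (auto simp: skip_def)

lemma inj_skip [simp]: "skip p i = skip p k \<longleftrightarrow> i = k"
  by (auto simp: skip_def)

text \<open>Serves both directions: \<open>A\<close> is the old matrix of an insertion and the new
  matrix of a deletion.\<close>

definition row_extension :: "nat \<Rightarrow> nat \<Rightarrow> nat \<Rightarrow> (nat \<Rightarrow> nat \<Rightarrow> 'a) \<Rightarrow> (nat \<Rightarrow> nat \<Rightarrow> 'a::zero) \<Rightarrow> bool" where
  "row_extension m n p A A' \<longleftrightarrow> p \<le> m \<and> (\<forall>i<m. \<forall>j<n. A' (skip p i) j = A i j) \<and> (\<forall>j<n. A' p j = 0)"

text \<open>Each of the two matrices is the other one multiplied from the left by a 0-1
  matrix.\<close>

lemma row_extension_fun_rank:
  assumes "row_extension m n p A A'"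
  shows "fun_rank (Suc m) n A' = fun_rank m n A"
proof (rule antisym)
  note * = assms[unfolded row_extension_def]
  show "fun_rank (Suc m) n A' \<le> fun_rank m n A"
  proof (rule fun_rank_left_mult_le[where L = "\<lambda>i k. if i = skip p k then 1 else 0"])
    fix i j assume ij: "i < Suc m" "j < n"
    consider "i = p" | k where "k < m" "i = skip p k" using skip_cases[OF ij(1), of p] * by blast
    then show "A' i j = (\<Sum>k<m. (if i = skip p k then 1 else 0) * A k j)"
    proof cases
      case 1
      then show ?thesis using * ij by (simp add: skip_neq[symmetric])
    next
      case (2 k)
      then show ?thesis using * ij by (simp add: if_distrib[of "\<lambda>x. x * _"] cong: if_cong)
    qed
  qed
  show "fun_rank m n A \<le> fun_rank (Suc m) n A'"
  proof (rule fun_rank_left_mult_le[where L = "\<lambda>i k. if k = skip p i then 1 else 0"])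
    fix i j assume ij: "i < m" "j < n"
    then show "A i j = (\<Sum>k<Suc m. (if k = skip p i then 1 else 0) * A' k j)"
      using * skip_less[OF ij(1), of p]
      by (simp add: if_distrib[of "\<lambda>x. x * _"] del: sum.lessThan_Suc cong: if_cong)
  qed
qed

text \<open>Row \<open>p\<close> of \<open>Y'\<close>, that is, column \<open>p\<close> of the
  inverse, is arbitrary, since it meets only the zero row of \<open>A'\<close>. A deletion can
  therefore simply drop it.\<close>

lemma row_extension_ginv:
  assumes A: "row_extension m n p A A'" and Y: "\<And>i j. i < m \<Longrightarrow> j < n \<Longrightarrow> Y' (skip p i) j = Y i j"
  shows "ginv (Suc m) n A' Y' \<longleftrightarrow> ginv m n A Y"
proof -
  note * = A[unfolded row_extension_def]
  have sum: "(\<Sum>k<Suc m. (\<Sum>l<n. A' i l * Y' k l) * A' k j) = (\<Sum>k<m. (\<Sum>l<n. A' i l * Y k l) * A k j)"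
    if "j < n" for i j
    using * Y that by (subst sum_skip[of p]) auto
  show ?thesis
  proof
    assume L: "ginv (Suc m) n A' Y'"
    show "ginv m n A Y"
      unfolding ginv_def
    proof (intro allI impI)
      fix i j assume ij: "i < m" "j < n"
      then show "(\<Sum>k<m. (\<Sum>l<n. A i l * Y k l) * A k j) = A i j"
        using L[unfolded ginv_def, rule_format, of "skip p i" j] sum[of j "skip p i"] * 
        by (simp add: skip_less)
    qed
  next
    assume R: "ginv m n A Y"
    show "ginv (Suc m) n A' Y'"
      unfolding ginv_def
    proof (intro allI impI)
      fix i j assume ij: "i < Suc m" "j < n"
      consider "i = p" | k where "k < m" "i = skip p k" using skip_cases[OF ij(1), of p] * by blast
      then show "(\<Sum>k<Suc m. (\<Sum>l<n. A' i l * Y' k l) * A' k j) = A' i j"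
        unfolding sum[OF ij(2)]
      proof cases
        case (2 k)
        then show "(\<Sum>k<m. (\<Sum>l<n. A' i l * Y k l) * A k j) = A' i j"
          using R[unfolded ginv_def, rule_format, of k j] * ij by simp
      qed (use * ij in auto)
    qed
  qed
qed

section \<open>Running programs\<close>

text \<open>Total correctness with a step budget: the exact count of \<open>big_step\<close> becomes
  an upper bound, which can be rounded up during composition.\<close>

definition runs ::
    "(nat \<Rightarrow> 'k::field) \<Rightarrow> nat \<Rightarrow> com \<Rightarrow> 'k state \<Rightarrow> ('k state \<Rightarrow> bool) \<Rightarrow> bool" where
  "runs \<omega> T c s Q \<longleftrightarrow> (\<exists>t s'. big_step \<omega> c s t s' \<and> t \<le> T \<and> Q s')"

lemma runs_mono:
  "runs \<omega> T c s Q \<Longrightarrow> T \<le> T' \<Longrightarrow> (\<And>s'. Q s' \<Longrightarrow> Q' s') \<Longrightarrow> runs \<omega> T' c s Q'"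
  unfolding runs_def by (meson order_trans)

lemma runs_Do: "1 \<le> T \<Longrightarrow> Q (exec_instr \<omega> i s) \<Longrightarrow> runs \<omega> T (Do i) s Q"
  unfolding runs_def using big_step.Do by blast

text \<open>The first program takes its own bound out of the budget and leaves the rest to its
  successor, so long sequences are verified from left to right.\<close>

lemma runs_Seq:
  assumes "runs \<omega> Tm c s Qm" "Tm \<le> T" "\<And>s'. Qm s' \<Longrightarrow> runs \<omega> (T - Tm) c' s' Q"
  shows "runs \<omega> T (Seq c c') s Q"
proof -
  from assms(1) obtain t s' where 1: "big_step \<omega> c s t s'" "t \<le> Tm" "Qm s'" unfolding runs_def by blast
  from assms(3)[OF 1(3)] obtain t' s'' where 2: "big_step \<omega> c' s' t' s''" "t' \<le> T - Tm" "Q s''"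
    unfolding runs_def by blast
  have "big_step \<omega> (Seq c c') s (t + t') s''" using 1 2 by (blast intro: big_step.Seq)
  moreover have "t + t' \<le> T" using 1 2 assms(2) by linarith
  ultimately show ?thesis using 2 unfolding runs_def by blast
qed

lemma runs_Seq_Do:
  "1 \<le> T \<Longrightarrow> runs \<omega> (T - 1) c (exec_instr \<omega> i s) Q \<Longrightarrow> runs \<omega> T (Seq (Do i) c) s Q"
  by (rule runs_Seq[where Qm = "\<lambda>s'. s' = exec_instr \<omega> i s"]) (auto intro: runs_Do)

lemma runs_Cond:
  assumes "1 \<le> T" "test_val s b \<Longrightarrow> runs \<omega> (T - 1) c s Q" "\<not> test_val s b \<Longrightarrow> runs \<omega> (T - 1) c' s Q"
  shows "runs \<omega> T (Cond b c c') s Q"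
proof (cases "test_val s b")
  case True
  with assms obtain t s' where "big_step \<omega> c s t s'" "t \<le> T - 1" "Q s'" unfolding runs_def by blast
  with big_step.CondT[OF True] assms(1) show ?thesis
    unfolding runs_def by (intro exI[of _ "1 + t"] exI[of _ s']) auto
next
  case False
  with assms obtain t s' where "big_step \<omega> c' s t s'" "t \<le> T - 1" "Q s'" unfolding runs_def by blast
  with big_step.CondF[OF False] assms(1) show ?thesis
    unfolding runs_def by (intro exI[of _ "1 + t"] exI[of _ s']) auto
qed

definition for_loop :: "nat \<Rightarrow> atom \<Rightarrow> com \<Rightarrow> com" where
  "for_loop r N c = Seq (Do (IMove r (Const 0))) (While (Less (Reg r) N) (Seq c (Do (IInc r))))"

text \<open>A round costs \<open>T + 2\<close> with its test and its increment; the initial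
  assignment and the last, failing test account for the final 2. \<open>J\<close> has to be stable
  under writing the loop register, because that happens between rounds.\<close>

lemma runs_for_loop:
  assumes body: "\<And>k s. k < b \<Longrightarrow> J k s \<Longrightarrow> regs s r = k \<Longrightarrow>
      runs \<omega> T c s (\<lambda>s'. J (Suc k) s' \<and> regs s' r = k)"
    and set: "\<And>k s x. J k s \<Longrightarrow> J k (set_reg r x s)"
    and bound: "\<And>k s. J k s \<Longrightarrow> atom_val s N = b"
    and init: "J 0 s"
  shows "runs \<omega> (b * (T + 2) + 2) (for_loop r N c) s (J b)"
proof -
  let ?W = "While (Less (Reg r) N) (Seq c (Do (IInc r)))"
  \<comment> \<open>Induction on the number \<open>d\<close> of remaining rounds.\<close>
  have W: "runs \<omega> (d * (T + 2) + 1) ?W s (J b)" if "J (b - d) s" "regs s r = b - d" "d \<le> b" for d s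
    using that
  proof (induction d arbitrary: s)
    case 0
    then show ?case
      unfolding runs_def using bound[OF 0(1)]
      by (intro exI[of _ 1] exI[of _ s]) (use 0 in \<open>simp add: big_step.WhileF del: One_nat_def\<close>)
  next
    case (Suc d)
    define k where "k = b - Suc d"
    have k: "k < b" "Suc k = b - d" using Suc.prems by (auto simp: k_def)
    obtain t s' where 1: "big_step \<omega> c s t s'" "t \<le> T" "J (Suc k) s'" "regs s' r = k"
      using body[of k s] Suc.prems k unfolding runs_def k_def by blast
    let ?s = "set_reg r (Suc k) s'"
    have "runs \<omega> (d * (T + 2) + 1) ?W ?s (J b)"
      by (rule Suc.IH) (use 1 k set Suc.prems in \<open>auto simp: set_reg_def\<close>)
    then obtain t' s'' where 2: "big_step \<omega> ?W ?s t' s''" "t' \<le> d * (T + 2) + 1" "J b s''"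
      unfolding runs_def by blast
    have "big_step \<omega> (Seq c (Do (IInc r))) s (t + 1) ?s"
      using big_step.Seq[OF 1(1) big_step.Do, of "IInc r"] 1(4) by simp
    from big_step.WhileT[OF _ this 2(1)] have "big_step \<omega> ?W s (1 + (t + 1) + t') s''"
      using Suc.prems bound[OF Suc.prems(1)] k by (simp add: k_def)
    then show ?case unfolding runs_def using 1 2 by (intro exI conjI) auto
  qed
  have "runs \<omega> (b * (T + 2) + 1) ?W (set_reg r 0 s) (J b)"
    by (rule W) (use init set in \<open>auto simp: set_reg_def\<close>)
  then show ?thesis unfolding for_loop_def by (intro runs_Seq_Do) simp_all
qed

definition agree_off :: "nat set \<Rightarrow> nat set \<Rightarrow> 'k state \<Rightarrow> 'k state \<Rightarrow> bool" where
  "agree_off R D s s' \<longleftrightarrow> (\<forall>r. r \<notin> R \<longrightarrow> regs s' r = regs s r) \<and> (\<forall>a. a \<notin> D \<longrightarrow> mem s' a = mem s a)"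

lemma agree_off_refl [simp]: "agree_off R D s s"
  by (simp add: agree_off_def)

lemma agree_off_trans:
  "agree_off R D s s' \<Longrightarrow> agree_off R' D' s' s'' \<Longrightarrow> R \<union> R' \<subseteq> R'' \<Longrightarrow> D \<union> D' \<subseteq> D'' \<Longrightarrow> agree_off R'' D'' s s''"
  unfolding agree_off_def by (metis UnCI subsetD)

lemma agree_off_set_reg: "agree_off R D s s' \<Longrightarrow> r \<in> R \<Longrightarrow> agree_off R D s (set_reg r x s')"
  by (simp add: agree_off_def set_reg_def)

fun atom_regs :: "atom \<Rightarrow> nat set" where
  "atom_regs (Const c) = {}"
| "atom_regs (Reg r) = {r}"

lemma agree_off_atom_val: "agree_off R D s s' \<Longrightarrow> atom_regs x \<inter> R = {} \<Longrightarrow> atom_val s' x = atom_val s x"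
  by (cases x) (auto simp: agree_off_def)

fun cell_array :: "cell \<Rightarrow> nat" where
  "cell_array (Cell a x y) = a"

text \<open>Input abbreviations leave numerals in the goals, so the simplifier decides which
  registers and arrays are distinct. The scratch registers avoid 0, 1 and 2, which belong to the
  interface.\<close>

abbreviation (input) "reg_i \<equiv> 20 :: nat"
abbreviation (input) "reg_j \<equiv> 21 :: nat"
abbreviation (input) "reg_k \<equiv> 22 :: nat"
abbreviation (input) "reg_t \<equiv> 23 :: nat"
abbreviation (input) "tmp_array \<equiv> 12 :: nat"
abbreviation (input) "tmp_cell \<equiv> Cell tmp_array (Const 0) (Const 0)"
abbreviation (input) "ij \<equiv> \<lambda>a. Cell a (Reg reg_i) (Reg reg_j)"

definition for2 :: "atom \<Rightarrow> atom \<Rightarrow> com \<Rightarrow> com" where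
  "for2 N1 N2 c = for_loop reg_i N1 (for_loop reg_j N2 c)"

text \<open>\<open>F i j\<close> is the content of array \<open>d\<close> before round
  \<open>(i, j)\<close>; the end of one row of rounds is the start of the next. \<open>W\<close>
  covers an extra row and column, which absorbs the overhead of both loops even for empty
  dimensions.\<close>

lemma runs_for2:
  assumes body: "\<And>i j s. i < n1 \<Longrightarrow> j < n2 \<Longrightarrow> agree_off R D s0 s \<Longrightarrow> mem s d = F i j \<Longrightarrow>
      regs s reg_i = i \<Longrightarrow> regs s reg_j = j \<Longrightarrow>
      runs \<omega> T c s (\<lambda>s'. agree_off R D s0 s' \<and> mem s' d = F i (Suc j) \<and>
        regs s' reg_i = i \<and> regs s' reg_j = j)"
    and F: "F 0 0 = mem s0 d" "\<And>i. i < n1 \<Longrightarrow> F i n2 = F (Suc i) 0"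
    and R: "reg_i \<in> R" "reg_j \<in> R" "atom_regs N1 \<inter> R = {}" "atom_regs N2 \<inter> R = {}"
    and n: "atom_val s0 N1 = n1" "atom_val s0 N2 = n2"
    and W: "Suc n1 * Suc n2 \<le> W"
  shows "runs \<omega> ((T + 6) * W) (for2 N1 N2 c) s0 (\<lambda>s'. agree_off R D s0 s' \<and> mem s' d = F n1 0)"
proof (rule runs_mono)
  show "runs \<omega> (n1 * ((n2 * (T + 2) + 2) + 2) + 2) (for2 N1 N2 c) s0
      (\<lambda>s. agree_off R D s0 s \<and> mem s d = F n1 0)"
    unfolding for2_def
  proof (rule runs_for_loop)
    fix i s
    assume i: "i < n1" and J: "agree_off R D s0 s \<and> mem s d = F i 0" and ri: "regs s reg_i = i"
    have "runs \<omega> (n2 * (T + 2) + 2) (for_loop reg_j N2 c) s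
        (\<lambda>s. agree_off R D s0 s \<and> mem s d = F i n2 \<and> regs s reg_i = i)"
    proof (rule runs_for_loop)
      fix j s
      assume "j < n2" "agree_off R D s0 s \<and> mem s d = F i j \<and> regs s reg_i = i" "regs s reg_j = j"
      then show "runs \<omega> T c s (\<lambda>s'. (agree_off R D s0 s' \<and> mem s' d = F i (Suc j) \<and>
          regs s' reg_i = i) \<and> regs s' reg_j = j)"
        using body[of i j s] i by simp
    qed (use J ri R n in \<open>auto simp: agree_off_atom_val agree_off_set_reg\<close>, auto simp: set_reg_def)
    then show "runs \<omega> (n2 * (T + 2) + 2) (for_loop reg_j N2 c) s
        (\<lambda>s. (agree_off R D s0 s \<and> mem s d = F (Suc i) 0) \<and> regs s reg_i = i)"
      using F(2)[OF i] by (simp add: conj_assoc)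
  qed (use R n F in \<open>auto simp: agree_off_atom_val agree_off_set_reg\<close>, auto simp: set_reg_def)
  have "n1 * ((n2 * (T + 2) + 2) + 2) + 2 \<le> (T + 6) * (Suc n1 * Suc n2)"
    by (simp add: algebra_simps)
  also have "\<dots> \<le> (T + 6) * W" using W by (intro mult_le_mono) auto
  finally show "n1 * ((n2 * (T + 2) + 2) + 2) + 2 \<le> (T + 6) * W" .
qed

text \<open>Rounds run in lexicographic order, so each finds its own cell unchanged. This admits
  bodies that read the cell which they overwrite.\<close>

lemma runs_fill:
  assumes body: "\<And>i j s. i < n1 \<Longrightarrow> j < n2 \<Longrightarrow> agree_off {reg_i, reg_j, reg_t} {d} s0 s \<Longrightarrow>
      mem s d i j = mem s0 d i j \<Longrightarrow> regs s reg_i = i \<Longrightarrow> regs s reg_j = j \<Longrightarrow>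
      runs \<omega> T c s (\<lambda>s'. agree_off {reg_t} {d} s s' \<and>
        mem s' d = (mem s d)(i := (mem s d i)(j := f i j)))"
    and R: "atom_regs N1 \<inter> {reg_i, reg_j, reg_t} = {}" "atom_regs N2 \<inter> {reg_i, reg_j, reg_t} = {}"
    and n: "atom_val s0 N1 = n1" "atom_val s0 N2 = n2"
    and W: "Suc n1 * Suc n2 \<le> W"
  shows "runs \<omega> ((T + 6) * W) (for2 N1 N2 c) s0 (\<lambda>s'. agree_off {reg_i, reg_j, reg_t} {d} s0 s' \<and>
    (\<forall>x y. mem s' d x y = (if x < n1 \<and> y < n2 then f x y else mem s0 d x y)))"
proof -
  define F where "F i j = (\<lambda>x y. if x < n1 \<and> y < n2 \<and> (x < i \<or> x = i \<and> y < j) then f x y else mem s0 d x y)"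
    for i j
  show ?thesis
  proof (rule runs_mono[OF runs_for2[where F = F]])
    fix i j s
    assume *: "i < n1" "j < n2" "agree_off {reg_i, reg_j, reg_t} {d} s0 s" "mem s d = F i j"
      "regs s reg_i = i" "regs s reg_j = j"
    have 1: "mem s d i j = mem s0 d i j" using * by (simp add: F_def)
    have F: "(F i j)(i := (F i j i)(j := f i j)) = F i (Suc j)"
      using * by (auto simp: F_def fun_eq_iff less_Suc_eq)
    show "runs \<omega> T c s (\<lambda>s'. agree_off {reg_i, reg_j, reg_t} {d} s0 s' \<and> mem s' d = F i (Suc j) \<and>
        regs s' reg_i = i \<and> regs s' reg_j = j)"
    proof (rule runs_mono[OF body[OF *(1-3) 1 *(5,6)]])
      fix s' assume s': "agree_off {reg_t} {d} s s' \<and> mem s' d = (mem s d)(i := (mem s d i)(j := f i j))"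
      then have "agree_off {reg_i, reg_j, reg_t} {d} s0 s'"
        using *(3) by (auto intro: agree_off_trans)
      then show "agree_off {reg_i, reg_j, reg_t} {d} s0 s' \<and> mem s' d = F i (Suc j) \<and>
          regs s' reg_i = i \<and> regs s' reg_j = j"
        using s' * F by (simp add: agree_off_def)
    qed simp
  qed (use R n W in \<open>auto simp: F_def fun_eq_iff\<close>)
qed

fun atom_at :: "'k state \<Rightarrow> nat \<Rightarrow> nat \<Rightarrow> atom \<Rightarrow> nat" where
  "atom_at s i j (Const c) = c"
| "atom_at s i j (Reg r) = (if r = reg_i then i else if r = reg_j then j else regs s r)"

text \<open>Operands of a loop body as functions of the counters, read off from the state before the
  loop; sound for arrays that the loop does not write.\<close>

fun cell_at :: "'k state \<Rightarrow> nat \<Rightarrow> nat \<Rightarrow> cell \<Rightarrow> 'k" where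
  "cell_at s i j (Cell a x y) = mem s a (atom_at s i j x) (atom_at s i j y)"

lemma atom_val_conv_at:
  "agree_off {reg_i, reg_j} D s0 s \<Longrightarrow> regs s reg_i = i \<Longrightarrow> regs s reg_j = j \<Longrightarrow> atom_val s x = atom_at s0 i j x"
  by (cases x) (auto simp: agree_off_def)

lemma get_conv_at:
  "agree_off {reg_i, reg_j} D s0 s \<Longrightarrow> regs s reg_i = i \<Longrightarrow> regs s reg_j = j \<Longrightarrow> cell_array E \<notin> D \<Longrightarrow>
     get s E = cell_at s0 i j E"
  by (cases E) (simp add: atom_val_conv_at, simp add: agree_off_def)

text \<open>The target \<open>D\<close> selects the operation: with one counter in it this is a
  product with a matrix or its transpose, with none a scalar product, with both a rank one change of
  a matrix.\<close>

definition accumulate :: "bool \<Rightarrow> atom \<Rightarrow> atom \<Rightarrow> cell \<Rightarrow> cell \<Rightarrow> cell \<Rightarrow> com" where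
  "accumulate neg N1 N2 D E1 E2 = for2 N1 N2 (Seq (Do (FMul tmp_cell E1 E2))
     (Do (if neg then FSub D D tmp_cell else FAdd D D tmp_cell)))"

lemma runs_accumulate:
  assumes arrays: "d \<noteq> tmp_array" "cell_array E1 \<notin> {d, tmp_array}" "cell_array E2 \<notin> {d, tmp_array}"
    and R: "atom_regs N1 \<inter> {reg_i, reg_j} = {}" "atom_regs N2 \<inter> {reg_i, reg_j} = {}"
    and n: "atom_val s0 N1 = n1" "atom_val s0 N2 = n2"
    and W: "Suc n1 * Suc n2 \<le> W"
  shows "runs \<omega> (8 * W) (accumulate neg N1 N2 (Cell d x0 y0) E1 E2) s0
    (\<lambda>s'. agree_off {reg_i, reg_j} {d, tmp_array} s0 s' \<and>
      (\<forall>x y. mem s' d x y = mem s0 d x y + (if neg then - 1 else 1) *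
        (\<Sum>i<n1. \<Sum>j<n2. if atom_at s0 i j x0 = x \<and> atom_at s0 i j y0 = y
           then cell_at s0 i j E1 * cell_at s0 i j E2 else 0)))"
proof -
  define \<sigma> :: 'a where "\<sigma> = (if neg then - 1 else 1)"
  define S where "S i j x y = (if atom_at s0 i j x0 = x \<and> atom_at s0 i j y0 = y
      then cell_at s0 i j E1 * cell_at s0 i j E2 else 0)" for i j x y
  define F where "F i j = (\<lambda>x y. mem s0 d x y + \<sigma> * ((\<Sum>i<i. \<Sum>j<n2. S i j x y) + (\<Sum>j<j. S i j x y)))"
    for i j
  have "runs \<omega> ((2 + 6) * W) (accumulate neg N1 N2 (Cell d x0 y0) E1 E2) s0
      (\<lambda>s'. agree_off {reg_i, reg_j} {d, tmp_array} s0 s' \<and> mem s' d = F n1 0)"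
    unfolding accumulate_def
  proof (rule runs_for2)
    fix i j s
    assume *: "i < n1" "j < n2" "agree_off {reg_i, reg_j} {d, tmp_array} s0 s" "mem s d = F i j"
      "regs s reg_i = i" "regs s reg_j = j"
    have F: "(F i j)(x := (F i j x)(y := F i j x y + \<sigma> * (cell_at s0 i j E1 * cell_at s0 i j E2)))
        = F i (Suc j)" if "x = atom_at s0 i j x0" "y = atom_at s0 i j y0" for x y
      using that by (auto simp: F_def S_def fun_eq_iff distrib_left add.assoc)
    show "runs \<omega> 2 (Seq (Do (FMul tmp_cell E1 E2))
        (Do (if neg then FSub (Cell d x0 y0) (Cell d x0 y0) tmp_cell
          else FAdd (Cell d x0 y0) (Cell d x0 y0) tmp_cell))) s
        (\<lambda>s'. agree_off {reg_i, reg_j} {d, tmp_array} s0 s' \<and> mem s' d = F i (Suc j) \<and>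
          regs s' reg_i = i \<and> regs s' reg_j = j)"
    proof (rule runs_Seq_Do, simp, rule runs_Do, simp)
      define s1 where "s1 = exec_instr \<omega> (FMul tmp_cell E1 E2) s"
      have E: "get s E1 = cell_at s0 i j E1" "get s E2 = cell_at s0 i j E2"
        using arrays * by (auto intro!: get_conv_at[where D = "{d, tmp_array}"])
      have 1: "agree_off {reg_i, reg_j} {d, tmp_array} s0 s1"
        using *(3) by (auto simp: s1_def agree_off_def)
      have s1: "mem s1 d = F i j" "mem s1 tmp_array 0 0 = cell_at s0 i j E1 * cell_at s0 i j E2"
        "regs s1 reg_i = i" "regs s1 reg_j = j"
        using * arrays E by (auto simp: s1_def)
      have xy: "atom_val s1 x = atom_at s0 i j x" for x
        using atom_val_conv_at[OF 1 s1(3,4)] .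
      show "agree_off {reg_i, reg_j} {d, tmp_array} s0 (exec_instr \<omega> (if neg then FSub (Cell d x0 y0) (Cell d x0 y0) tmp_cell
          else FAdd (Cell d x0 y0) (Cell d x0 y0) tmp_cell) s1) \<and>
        mem (exec_instr \<omega> (if neg then FSub (Cell d x0 y0) (Cell d x0 y0) tmp_cell
          else FAdd (Cell d x0 y0) (Cell d x0 y0) tmp_cell) s1) d = F i (Suc j) \<and>
        regs (exec_instr \<omega> (if neg then FSub (Cell d x0 y0) (Cell d x0 y0) tmp_cell
          else FAdd (Cell d x0 y0) (Cell d x0 y0) tmp_cell) s1) reg_i = i \<and>
        regs (exec_instr \<omega> (if neg then FSub (Cell d x0 y0) (Cell d x0 y0) tmp_cell
          else FAdd (Cell d x0 y0) (Cell d x0 y0) tmp_cell) s1) reg_j = j"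
        using 1 s1 F[OF refl refl] by (cases neg) (simp_all add: xy \<sigma>_def, auto simp: agree_off_def)
    qed
  qed (use R n W in \<open>auto simp: F_def\<close>)
  then show ?thesis by (rule runs_mono) (auto simp: F_def S_def \<sigma>_def)
qed

text \<open>A zero in array \<open>c\<close> encodes that nothing was found; register
  \<open>p\<close> then keeps its old value, which may be out of range.\<close>

definition find_nonzero :: "nat \<Rightarrow> atom \<Rightarrow> nat \<Rightarrow> nat \<Rightarrow> com" where
  "find_nonzero p N a c = Seq (Do (FZero (Cell c (Const 0) (Const 0))))
     (for_loop reg_i N (Cond (Is_Zero (Cell a (Reg reg_i) (Const 0))) (Do (IMove reg_t (Const 0)))
       (Seq (Do (IMove p (Reg reg_i))) (Do (FCopy (Cell c (Const 0) (Const 0)) (Cell a (Reg reg_i) (Const 0)))))))"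

lemma runs_find_nonzero:
  assumes R: "p \<notin> {reg_i, reg_t}" "atom_regs N \<inter> {reg_i, reg_t, p} = {}" and a: "a \<noteq> c"
    and n: "atom_val s0 N = n" and W: "Suc n \<le> W"
  shows "runs \<omega> (8 * W) (find_nonzero p N a c) s0 (\<lambda>s'. agree_off {reg_i, reg_t, p} {c} s0 s' \<and>
    (mem s' c 0 0 = 0 \<and> (\<forall>i<n. mem s0 a i 0 = 0) \<or>
     regs s' p < n \<and> mem s' c 0 0 = mem s0 a (regs s' p) 0 \<and> mem s' c 0 0 \<noteq> 0))"
proof (rule runs_mono)
  define J where "J k s' \<longleftrightarrow> agree_off {reg_i, reg_t, p} {c} s0 s' \<and>
    (mem s' c 0 0 = 0 \<and> (\<forall>i<k. mem s0 a i 0 = 0) \<or>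
     regs s' p < k \<and> mem s' c 0 0 = mem s0 a (regs s' p) 0 \<and> mem s' c 0 0 \<noteq> 0)" for k s'
  have "runs \<omega> (n * (3 + 2) + 2) (for_loop reg_i N (Cond (Is_Zero (Cell a (Reg reg_i) (Const 0))) (Do (IMove reg_t (Const 0)))
       (Seq (Do (IMove p (Reg reg_i))) (Do (FCopy (Cell c (Const 0) (Const 0)) (Cell a (Reg reg_i) (Const 0)))))))
     (exec_instr \<omega> (FZero (Cell c (Const 0) (Const 0))) s0) (J n)"
  proof (rule runs_for_loop)
    fix k s assume k: "k < n" "J k s" "regs s reg_i = k"
    then have "mem s a k 0 = mem s0 a k 0" using a by (auto simp: J_def agree_off_def)
    then show "runs \<omega> 3 (Cond (Is_Zero (Cell a (Reg reg_i) (Const 0))) (Do (IMove reg_t (Const 0)))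
       (Seq (Do (IMove p (Reg reg_i))) (Do (FCopy (Cell c (Const 0) (Const 0)) (Cell a (Reg reg_i) (Const 0))))))
      s (\<lambda>s'. J (Suc k) s' \<and> regs s' reg_i = k)"
      using k R a
      by (intro runs_Cond runs_Seq_Do runs_Do)
        (auto simp: J_def set_reg_def agree_off_def less_Suc_eq)
  next
    show "J k s \<Longrightarrow> atom_val s N = n" for k s
      using agree_off_atom_val[of "{reg_i, reg_t, p}" "{c}" s0 s N] R n by (simp add: J_def)
  qed (use R in \<open>auto simp: J_def agree_off_def set_reg_def\<close>)
  then show "runs \<omega> (n * (3 + 2) + 3) (find_nonzero p N a c) s0 (J n)"
    unfolding find_nonzero_def by (intro runs_Seq_Do) auto
  show "n * (3 + 2) + 3 \<le> 8 * W" using W by simp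
qed (simp)

section \<open>The rank one update\<close>

lemma double_sum_row:
  fixes f :: "nat \<Rightarrow> nat \<Rightarrow> 'a::comm_monoid_add"
  assumes "x < n1"
  shows "(\<Sum>i<n1. \<Sum>j<n2. if i = x then f i j else 0) = (\<Sum>j<n2. f x j)"
  using assms by (subst sum.swap) simp

abbreviation (input) "at_i \<equiv> \<lambda>a. Cell a (Reg reg_i) (Const 0)"
abbreviation (input) "at_j \<equiv> \<lambda>a. Cell a (Reg reg_j) (Const 0)"
abbreviation (input) "scalar \<equiv> \<lambda>a. Cell a (Const 0) (Const 0)"

lemma runs_accumulate_row:
  assumes "d \<noteq> tmp_array" "cell_array E1 \<notin> {d, tmp_array}" "cell_array E2 \<notin> {d, tmp_array}"
    and "atom_regs N1 \<inter> {reg_i, reg_j} = {}" "atom_regs N2 \<inter> {reg_i, reg_j} = {}"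
    and "Suc (atom_val s N1) * Suc (atom_val s N2) \<le> W"
  shows "runs \<omega> (8 * W) (accumulate neg N1 N2 (at_i d) E1 E2) s
    (\<lambda>s'. agree_off {reg_i, reg_j} {d, tmp_array} s s' \<and>
      (\<forall>x<atom_val s N1. mem s' d x 0 = mem s d x 0 + (if neg then - 1 else 1) *
        (\<Sum>j<atom_val s N2. cell_at s x j E1 * cell_at s x j E2)))"
  by (rule runs_mono[OF runs_accumulate[OF assms(1-5) refl refl assms(6)] order_refl])
    (simp add: double_sum_row)

lemma runs_accumulate_col:
  assumes "d \<noteq> tmp_array" "cell_array E1 \<notin> {d, tmp_array}" "cell_array E2 \<notin> {d, tmp_array}"
    and "atom_regs N1 \<inter> {reg_i, reg_j} = {}" "atom_regs N2 \<inter> {reg_i, reg_j} = {}"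
    and "Suc (atom_val s N1) * Suc (atom_val s N2) \<le> W"
  shows "runs \<omega> (8 * W) (accumulate neg N1 N2 (at_j d) E1 E2) s
    (\<lambda>s'. agree_off {reg_i, reg_j} {d, tmp_array} s s' \<and>
      (\<forall>y<atom_val s N2. mem s' d y 0 = mem s d y 0 + (if neg then - 1 else 1) *
        (\<Sum>i<atom_val s N1. cell_at s i y E1 * cell_at s i y E2)))"
  by (rule runs_mono[OF runs_accumulate[OF assms(1-5) refl refl assms(6)] order_refl]) simp

lemma runs_accumulate_scalar:
  assumes "d \<noteq> tmp_array" "cell_array E1 \<notin> {d, tmp_array}" "cell_array E2 \<notin> {d, tmp_array}"
    and "atom_regs N2 \<inter> {reg_i, reg_j} = {}"
    and "Suc 1 * Suc (atom_val s N2) \<le> W"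
  shows "runs \<omega> (8 * W) (accumulate neg (Const 1) N2 (scalar d) E1 E2) s
    (\<lambda>s'. agree_off {reg_i, reg_j} {d, tmp_array} s s' \<and>
      mem s' d 0 0 = mem s d 0 0 + (if neg then - 1 else 1) *
        (\<Sum>j<atom_val s N2. cell_at s 0 j E1 * cell_at s 0 j E2))"
  by (rule runs_mono[OF runs_accumulate[OF assms(1-3) _ assms(4) refl refl] order_refl])
    (use assms(5) in simp_all)

lemma runs_accumulate_mat:
  assumes "d \<noteq> tmp_array" "cell_array E1 \<notin> {d, tmp_array}" "cell_array E2 \<notin> {d, tmp_array}"
    and "atom_regs N1 \<inter> {reg_i, reg_j} = {}" "atom_regs N2 \<inter> {reg_i, reg_j} = {}"
    and "Suc (atom_val s N1) * Suc (atom_val s N2) \<le> W"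
  shows "runs \<omega> (8 * W) (accumulate neg N1 N2 (ij d) E1 E2) s
    (\<lambda>s'. agree_off {reg_i, reg_j} {d, tmp_array} s s' \<and>
      (\<forall>x<atom_val s N1. \<forall>y<atom_val s N2. mem s' d x y = mem s d x y +
        (if neg then - 1 else 1) * (cell_at s x y E1 * cell_at s x y E2)))"
proof (rule runs_mono[OF runs_accumulate[OF assms(1-5) refl refl assms(6)] order_refl])
  have "(\<Sum>i<n1. \<Sum>j<n2. if i = x \<and> j = y then f i j else 0) = f x y"
    if "x < n1" "y < n2" for n1 n2 x y and f :: "nat \<Rightarrow> nat \<Rightarrow> 'a"
  proof -
    have "(\<Sum>i<n1. \<Sum>j<n2. if i = x \<and> j = y then f i j else 0)
        = (\<Sum>i<n1. \<Sum>j<n2. if i = x then (if j = y then f i j else 0) else 0)"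
      by (intro sum.cong) auto
    then show ?thesis using that by (simp add: double_sum_row)
  qed
  then show "agree_off {reg_i, reg_j} {d, tmp_array} s s' \<and> (\<forall>x<atom_val s N1. \<forall>y<atom_val s N2.
      mem s' d x y = mem s d x y + (if neg then - 1 else 1) * (cell_at s x y E1 * cell_at s x y E2))"
    if "agree_off {reg_i, reg_j} {d, tmp_array} s s' \<and>
      (\<forall>x y. mem s' d x y = mem s d x y + (if neg then - 1 else 1) *
        (\<Sum>i<atom_val s N1. \<Sum>j<atom_val s N2.
          if atom_at s i j (Reg reg_i) = x \<and> atom_at s i j (Reg reg_j) = y
          then cell_at s i j E1 * cell_at s i j E2 else 0))" for s'
    using that by simp
qed

definition clear :: "nat \<Rightarrow> atom \<Rightarrow> com" where
  "clear a N = for2 N (Const 1) (Do (FZero (ij a)))"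

definition copy :: "nat \<Rightarrow> atom \<Rightarrow> atom \<Rightarrow> cell \<Rightarrow> com" where
  "copy a N1 N2 E = for2 N1 N2 (Do (FCopy (ij a) E))"

definition divide_all :: "nat \<Rightarrow> atom \<Rightarrow> nat \<Rightarrow> com" where
  "divide_all a N c = for2 N (Const 1) (Do (FDiv (ij a) (ij a) (scalar c)))"

lemma runs_clear:
  assumes "atom_regs N \<inter> {reg_i, reg_j, reg_t} = {}" "Suc (atom_val s N) * Suc 1 \<le> W"
  shows "runs \<omega> (7 * W) (clear a N) s (\<lambda>s'. agree_off {reg_i, reg_j, reg_t} {a} s s' \<and>
    (\<forall>x<atom_val s N. mem s' a x 0 = 0))"
  unfolding clear_def
proof (rule runs_mono[OF runs_fill[where f = "\<lambda>_ _. 0" and T = 1 and W = W]])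
qed (use assms in \<open>auto intro!: runs_Do simp: agree_off_def\<close>)

lemma runs_copy:
  assumes "atom_regs N1 \<inter> {reg_i, reg_j, reg_t} = {}" "atom_regs N2 \<inter> {reg_i, reg_j, reg_t} = {}"
    and E: "E = Cell b x y" "reg_t \<notin> atom_regs x \<union> atom_regs y" "b \<noteq> a"
    and "Suc (atom_val s N1) * Suc (atom_val s N2) \<le> W"
  shows "runs \<omega> (7 * W) (copy a N1 N2 E) s (\<lambda>s'. agree_off {reg_i, reg_j, reg_t} {a} s s' \<and>
    (\<forall>x<atom_val s N1. \<forall>y<atom_val s N2. mem s' a x y = cell_at s x y E))"
  unfolding copy_def
proof (rule runs_mono[OF runs_fill[where f = "\<lambda>i j. cell_at s i j E" and T = 1 and W = W]])
  fix i j s'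
  assume *: "agree_off {reg_i, reg_j, reg_t} {a} s s'" "regs s' reg_i = i" "regs s' reg_j = j"
  have "atom_val s' x = atom_at s i j x" if "reg_t \<notin> atom_regs x" for x
    using * that by (cases x) (auto simp: agree_off_def)
  then have "get s' E = cell_at s i j E" using E * by (auto simp: agree_off_def)
  then show "runs \<omega> 1 (Do (FCopy (ij a) E)) s' (\<lambda>s''. agree_off {reg_t} {a} s' s'' \<and>
      mem s'' a = (mem s' a)(i := (mem s' a i)(j := cell_at s i j E)))"
    using * by (auto intro!: runs_Do simp: agree_off_def)
qed (use assms in auto)

lemma runs_divide_all:
  assumes "atom_regs N \<inter> {reg_i, reg_j, reg_t} = {}" "a \<noteq> c" "Suc (atom_val s N) * Suc 1 \<le> W"
  shows "runs \<omega> (7 * W) (divide_all a N c) s (\<lambda>s'. agree_off {reg_i, reg_j, reg_t} {a} s s' \<and>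
    (\<forall>x<atom_val s N. mem s' a x 0 = mem s a x 0 / mem s c 0 0))"
  unfolding divide_all_def
proof (rule runs_mono[OF runs_fill[where f = "\<lambda>i j. mem s a i j / mem s c 0 0" and T = 1 and W = W]])
qed (use assms in \<open>auto intro!: runs_Do simp: agree_off_def\<close>)

text \<open>Arrays 1 and 2 are those in which the operands of updates arrive. The maintained matrix
  and its transposed inverse live in arrays 3 and 4, so that array 0 keeps the input during the
  initialisation.\<close>

abbreviation (input) "reg_m \<equiv> 10 :: nat"
abbreviation (input) "reg_n \<equiv> 11 :: nat"
abbreviation (input) "reg_rank \<equiv> 12 :: nat"
abbreviation (input) "reg_p \<equiv> 13 :: nat"
abbreviation (input) "reg_q \<equiv> 14 :: nat"
abbreviation (input) "arr_u \<equiv> 1 :: nat"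
abbreviation (input) "arr_v \<equiv> 2 :: nat"
abbreviation (input) "arr_A \<equiv> 3 :: nat"
abbreviation (input) "arr_Y \<equiv> 4 :: nat"
abbreviation (input) "arr_a \<equiv> 5 :: nat"
abbreviation (input) "arr_b \<equiv> 6 :: nat"
abbreviation (input) "arr_e \<equiv> 7 :: nat"
abbreviation (input) "arr_f \<equiv> 8 :: nat"
abbreviation (input) "arr_g \<equiv> 9 :: nat"
abbreviation (input) "arr_h \<equiv> 10 :: nat"
abbreviation (input) "arr_e0 \<equiv> 13 :: nat"
abbreviation (input) "arr_f0 \<equiv> 14 :: nat"
abbreviation (input) "arr_beta \<equiv> 15 :: nat"
abbreviation (input) "arr_gamma \<equiv> 16 :: nat"
abbreviation (input) "M \<equiv> Reg reg_m"
abbreviation (input) "N \<equiv> Reg reg_n"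

abbreviation skip_com :: com where
  "skip_com \<equiv> Do (IMove reg_t (Const 0))"

fun seqs :: "com list \<Rightarrow> com" where
  "seqs [] = skip_com"
| "seqs [c] = c"
| "seqs (c # cs) = Seq c (seqs cs)"

definition products :: com where
  "products = seqs [
     clear arr_a N,
     clear arr_b M,
     accumulate False M N (at_j arr_a) (ij arr_Y) (at_i arr_u),
     accumulate False M N (at_i arr_b) (ij arr_Y) (at_j arr_v),
     copy arr_e M (Const 1) (ij arr_u),
     copy arr_f N (Const 1) (ij arr_v),
     accumulate True M N (at_i arr_e) (ij arr_A) (at_j arr_a),
     accumulate True M N (at_j arr_f) (ij arr_A) (at_i arr_b),
     Do (FOne (scalar arr_beta)),
     accumulate False (Const 1) N (scalar arr_beta) (at_j arr_v) (at_j arr_a)]"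

text \<open>The factor 2 in \<open>W\<close> pays for the loops whose second bound is 1: they need
  \<open>2 * Suc m\<close> or \<open>2 * Suc n\<close>.\<close>

lemma runs_products:
  assumes "regs s reg_m = m" "regs s reg_n = n" "W = 2 * (Suc m * Suc n)"
  shows "runs \<omega> (80 * W) products s (\<lambda>s'.
    agree_off {reg_i, reg_j, reg_t} {arr_a, arr_b, arr_e, arr_f, arr_beta, tmp_array} s s' \<and>
    (\<forall>j<n. mem s' arr_a j 0 = (\<Sum>i<m. mem s arr_Y i j * mem s arr_u i 0)) \<and>
    (\<forall>i<m. mem s' arr_b i 0 = (\<Sum>j<n. mem s arr_Y i j * mem s arr_v j 0)) \<and>
    (\<forall>i<m. mem s' arr_e i 0 = mem s arr_u i 0 - (\<Sum>j<n. mem s arr_A i j * mem s' arr_a j 0)) \<and>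
    (\<forall>j<n. mem s' arr_f j 0 = mem s arr_v j 0 - (\<Sum>i<m. mem s arr_A i j * mem s' arr_b i 0)) \<and>
    mem s' arr_beta 0 0 = 1 + (\<Sum>j<n. mem s arr_v j 0 * mem s' arr_a j 0))"
  unfolding products_def seqs.simps
  apply (rule runs_Seq, rule runs_clear[where W = W], (simp add: assms agree_off_def; fail)+)
  apply (rule runs_Seq, rule runs_clear[where W = W], (simp add: assms agree_off_def; fail)+)
  apply (rule runs_Seq, rule runs_accumulate_col[where W = W], (simp add: assms agree_off_def; fail)+)
  apply (rule runs_Seq, rule runs_accumulate_row[where W = W], (simp add: assms agree_off_def; fail)+)
  apply (rule runs_Seq, rule runs_copy[where W = W], (simp add: assms agree_off_def; fail)+)
  apply (rule runs_Seq, rule runs_copy[where W = W], (simp add: assms agree_off_def; fail)+)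
  apply (rule runs_Seq, rule runs_accumulate_row[where W = W], (simp add: assms agree_off_def; fail)+)
  apply (rule runs_Seq, rule runs_accumulate_col[where W = W], (simp add: assms agree_off_def; fail)+)
  apply (rule runs_Seq_Do, (simp add: assms; fail))
  apply (rule runs_mono, rule runs_accumulate_scalar[where W = W], (simp add: assms agree_off_def; fail)+)
  done

definition residuals :: com where
  "residuals = seqs [
     find_nonzero reg_p M arr_e arr_e0,
     clear arr_g M,
     Do (FOne (Cell arr_g (Reg reg_p) (Const 0))),
     accumulate True M N (at_i arr_g) (Cell arr_A (Reg reg_p) (Reg reg_j)) (ij arr_Y),
     divide_all arr_g M arr_e0,
     find_nonzero reg_q N arr_f arr_f0,
     clear arr_h N,
     Do (FOne (Cell arr_h (Reg reg_q) (Const 0))),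
     accumulate True M N (at_j arr_h) (ij arr_Y) (Cell arr_A (Reg reg_i) (Reg reg_q)),
     divide_all arr_h N arr_f0]"

lemma runs_residuals:
  assumes "regs s reg_m = m" "regs s reg_n = n" "W = 2 * (Suc m * Suc n)"
  shows "runs \<omega> (80 * W) residuals s (\<lambda>s'.
    agree_off {reg_p, reg_q, reg_i, reg_j, reg_t} {arr_g, arr_h, arr_e0, arr_f0, tmp_array} s s' \<and>
    (mem s' arr_e0 0 0 = 0 \<and> (\<forall>i<m. mem s arr_e i 0 = 0) \<or>
     regs s' reg_p < m \<and> mem s' arr_e0 0 0 = mem s arr_e (regs s' reg_p) 0 \<and> mem s' arr_e0 0 0 \<noteq> 0) \<and>
    (mem s' arr_f0 0 0 = 0 \<and> (\<forall>j<n. mem s arr_f j 0 = 0) \<or>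
     regs s' reg_q < n \<and> mem s' arr_f0 0 0 = mem s arr_f (regs s' reg_q) 0 \<and> mem s' arr_f0 0 0 \<noteq> 0) \<and>
    (\<forall>k<m. mem s' arr_g k 0 = ((if k = regs s' reg_p then 1 else 0) -
       (\<Sum>j<n. mem s arr_A (regs s' reg_p) j * mem s arr_Y k j)) / mem s' arr_e0 0 0) \<and>
    (\<forall>j<n. mem s' arr_h j 0 = ((if j = regs s' reg_q then 1 else 0) -
       (\<Sum>k<m. mem s arr_Y k j * mem s arr_A k (regs s' reg_q))) / mem s' arr_f0 0 0))"
  unfolding residuals_def seqs.simps
  apply (rule runs_Seq, rule runs_find_nonzero[where W = W and n = m], (simp add: assms agree_off_def; fail)+)
  apply (rule runs_Seq, rule runs_clear[where W = W], (simp add: assms agree_off_def; fail)+)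
  apply (rule runs_Seq_Do, (simp add: assms; fail))
  apply (rule runs_Seq, rule runs_accumulate_row[where W = W], (simp add: assms agree_off_def; fail)+)
  apply (rule runs_Seq, rule runs_divide_all[where W = W], (simp add: assms agree_off_def; fail)+)
  apply (rule runs_Seq, rule runs_find_nonzero[where W = W and n = n], (simp add: assms agree_off_def; fail)+)
  apply (rule runs_Seq, rule runs_clear[where W = W], (simp add: assms agree_off_def; fail)+)
  apply (rule runs_Seq_Do, (simp add: assms; fail))
  apply (rule runs_Seq, rule runs_accumulate_col[where W = W], (simp add: assms agree_off_def; fail)+)
  apply (rule runs_mono, rule runs_divide_all[where W = W], (simp add: assms agree_off_def; fail)+)
  done

text \<open>
  Division by zero yields \<open>\<gamma> = 0\<close> if \<open>\<beta> = 0\<close>; likewise \<^const>\<open>residuals\<close> leaves \<open>g = 0\<close> or \<open>h = 0\<close>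
  if \<open>e\<close> or \<open>f\<close> vanishes.
\<close>

definition adjust_rank :: com where
  "adjust_rank = Seq (Do (FZero (scalar arr_gamma)))
     (Cond (Is_Zero (scalar arr_e0))
       (Cond (Is_Zero (scalar arr_f0))
         (seqs [Do (FOne (scalar arr_gamma)),
            Do (FDiv (scalar arr_gamma) (scalar arr_gamma) (scalar arr_beta)),
            Cond (Is_Zero (scalar arr_beta)) (Do (IDec reg_rank)) skip_com])
         skip_com)
       (Cond (Is_Zero (scalar arr_f0)) skip_com (Do (IInc reg_rank))))"

lemma runs_adjust_rank:
  "runs \<omega> 8 adjust_rank s (\<lambda>s'.
    agree_off {reg_rank, reg_t} {arr_gamma} s s' \<and>
    mem s' arr_gamma 0 0 = (if mem s arr_e0 0 0 = 0 \<and> mem s arr_f0 0 0 = 0 then 1 / mem s arr_beta 0 0 else 0) \<and>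
    regs s' reg_rank =
      (if mem s arr_e0 0 0 = 0
       then (if mem s arr_f0 0 0 = 0 \<and> mem s arr_beta 0 0 = 0 then regs s reg_rank - 1 else regs s reg_rank)
       else (if mem s arr_f0 0 0 = 0 then regs s reg_rank else regs s reg_rank + 1)))"
  unfolding adjust_rank_def seqs.simps
  by (intro runs_Seq_Do runs_Cond runs_Do) (auto simp: agree_off_def set_reg_def)

text \<open>The first two loops overwrite \<open>a\<close> by \<open>c = a - \<beta> h\<close> and
  \<open>h\<close> by \<open>d = h + \<gamma> c\<close>; the outer bound 1 makes them loops over a
  vector. The next two subtract the transposes of \<open>c g^T\<close> and
  \<open>d b^T\<close>.\<close>

definition update_inverse :: com where
  "update_inverse = seqs [
     accumulate True (Const 1) N (at_j arr_a) (scalar arr_beta) (at_j arr_h),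
     accumulate False (Const 1) N (at_j arr_h) (scalar arr_gamma) (at_j arr_a),
     accumulate True M N (ij arr_Y) (at_j arr_a) (at_i arr_g),
     accumulate True M N (ij arr_Y) (at_j arr_h) (at_i arr_b),
     accumulate False M N (ij arr_A) (at_i arr_u) (at_j arr_v)]"

lemma runs_update_inverse:
  assumes "regs s reg_m = m" "regs s reg_n = n" "W = 2 * (Suc m * Suc n)"
  shows "runs \<omega> (40 * W) update_inverse s (\<lambda>s'.
    agree_off {reg_i, reg_j} {arr_a, arr_h, arr_Y, arr_A, tmp_array} s s' \<and>
    (\<forall>i<m. \<forall>j<n. mem s' arr_A i j = mem s arr_A i j + mem s arr_u i 0 * mem s arr_v j 0) \<and>
    (\<forall>i<m. \<forall>j<n. mem s' arr_Y i j = mem s arr_Y i j -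
       (mem s arr_a j 0 - mem s arr_beta 0 0 * mem s arr_h j 0) * mem s arr_g i 0 -
       (mem s arr_h j 0 + mem s arr_gamma 0 0 *
          (mem s arr_a j 0 - mem s arr_beta 0 0 * mem s arr_h j 0)) * mem s arr_b i 0))"
  unfolding update_inverse_def seqs.simps
  apply (rule runs_Seq, rule runs_accumulate_col[where W = W], (simp add: assms agree_off_def; fail)+)
  apply (rule runs_Seq, rule runs_accumulate_col[where W = W], (simp add: assms agree_off_def; fail)+)
  apply (rule runs_Seq, rule runs_accumulate_mat[where W = W], (simp add: assms agree_off_def; fail)+)
  apply (rule runs_Seq, rule runs_accumulate_mat[where W = W], (simp add: assms agree_off_def; fail)+)
  apply (rule runs_mono, rule runs_accumulate_mat[where W = W], (simp add: assms agree_off_def; fail)+)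
  done

definition rank_one :: com where
  "rank_one = seqs [products, residuals, adjust_rank, update_inverse]"

text \<open>The invariant singles out no particular generalised inverse.\<close>

definition represents :: "nat \<Rightarrow> nat \<Rightarrow> 'k::field state \<Rightarrow> bool" where
  "represents m n s \<longleftrightarrow> regs s reg_m = m \<and> regs s reg_n = n \<and>
     ginv m n (mem s arr_A) (mem s arr_Y) \<and> regs s reg_rank = fun_rank m n (mem s arr_A)"

lemma runs_rank_one:
  assumes s: "represents m n s"
  shows "runs \<omega> (500 * (Suc m * Suc n)) rank_one s (\<lambda>s'. represents m n s' \<and>
    regs s' 0 = regs s 0 \<and> regs s' reg_k = regs s reg_k \<and> mem s' 0 = mem s 0 \<and>
    (\<forall>i<m. \<forall>j<n. mem s' arr_A i j = mem s arr_A i j + mem s arr_u i 0 * mem s arr_v j 0))"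
proof -
  define W where "W = 2 * (Suc m * Suc n)"
  have W: "1 \<le> W" by (simp add: W_def)
  have mn: "regs s reg_m = m" "regs s reg_n = n" using s by (auto simp: represents_def)
  \<comment> \<open>The four stages cost 80, 80, 8 and 40 times \<open>W\<close>; with the factor 2
    in \<open>W\<close> this makes 416, rounded up to 500.\<close>
  have "runs \<omega> (208 * W) rank_one s (\<lambda>s'. represents m n s' \<and>
    regs s' 0 = regs s 0 \<and> regs s' reg_k = regs s reg_k \<and> mem s' 0 = mem s 0 \<and>
    (\<forall>i<m. \<forall>j<n. mem s' arr_A i j = mem s arr_A i j + mem s arr_u i 0 * mem s arr_v j 0))"
    unfolding rank_one_def seqs.simps
    apply (rule runs_Seq, rule runs_products[OF _ _ W_def], (simp add: mn; fail)+)
    apply (rule runs_Seq, rule runs_residuals[OF _ _ W_def], (simp add: mn agree_off_def; fail)+)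
    apply (rule runs_Seq, rule runs_adjust_rank, (use W in \<open>simp add: mn agree_off_def\<close>; fail)+)
    apply (rule runs_mono, rule runs_update_inverse[OF _ _ W_def], (use W in \<open>simp add: mn agree_off_def\<close>; fail)+)
    subgoal premises P for s1 s2 s3 s4
    proof -
      \<comment> \<open>Each quantity is taken from the state in which it was computed:
        \<open>s1\<close> after \<open>products\<close>, \<open>s2\<close> after
        \<open>residuals\<close>, \<open>s3\<close> after \<open>adjust_rank\<close>. In
        \<open>s4\<close> the arrays of \<open>a\<close> and \<open>h\<close> are already
        overwritten.\<close>
      interpret rank_one_step m n "mem s arr_A" "mem s arr_Y" "\<lambda>i. mem s arr_u i 0" "\<lambda>j. mem s arr_v j 0"
        "\<lambda>j. mem s1 arr_a j 0" "\<lambda>i. mem s1 arr_b i 0" "\<lambda>i. mem s1 arr_e i 0" "\<lambda>j. mem s1 arr_f j 0"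
        "\<lambda>k. mem s2 arr_g k 0" "\<lambda>j. mem s2 arr_h j 0" "mem s1 arr_beta 0 0" "mem s3 arr_gamma 0 0"
        "mem s2 arr_e0 0 0" "mem s2 arr_f0 0 0" "regs s2 reg_p" "regs s2 reg_q"
        by unfold_locales (use P s in \<open>simp_all add: agree_off_def represents_def\<close>)
      have A: "mem s4 arr_A i j = mem s arr_A i j + mem s arr_u i 0 * mem s arr_v j 0"
        if "i < m" "j < n" for i j
        using P that by (simp add: agree_off_def)
      have Y: "mem s4 arr_Y i j = mem s arr_Y i j
          - (mem s1 arr_a j 0 - mem s1 arr_beta 0 0 * mem s2 arr_h j 0) * mem s2 arr_g i 0
          - (mem s2 arr_h j 0 + mem s3 arr_gamma 0 0 *
              (mem s1 arr_a j 0 - mem s1 arr_beta 0 0 * mem s2 arr_h j 0)) * mem s1 arr_b i 0"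
        if "i < m" "j < n" for i j
        using P that by (simp add: agree_off_def)
      have "ginv m n (mem s4 arr_A) (mem s4 arr_Y)"
        using ginv_update by (subst ginv_cong[OF A Y])
      moreover have "regs s4 reg_rank = fun_rank m n (mem s4 arr_A)"
        using P rank_update s by (simp add: fun_rank_cong[OF A] agree_off_def represents_def)
      ultimately show ?thesis using P A mn by (simp add: represents_def agree_off_def)
    qed
    done
  then show ?thesis by (rule runs_mono) (auto simp: W_def)
qed

section \<open>Inserting and deleting rows and columns\<close>

abbreviation (input) "arr_t \<equiv> 11 :: nat"

definition insert_body :: "nat \<Rightarrow> cell \<Rightarrow> com" where
  "insert_body r E = Seq (Do (IMove reg_t (Reg r)))
     (Cond (Less (Reg r) (Reg 0)) (Do (FCopy (ij arr_t) E))
       (Cond (Equal (Reg r) (Reg 0)) (Do (FZero (ij arr_t)))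
         (Seq (Do (IDec reg_t)) (Do (FCopy (ij arr_t) E)))))"

definition delete_body :: "nat \<Rightarrow> cell \<Rightarrow> com" where
  "delete_body r E = Seq (Do (IMove reg_t (Reg r)))
     (Cond (Less (Reg r) (Reg 0)) (Do (FCopy (ij arr_t) E))
       (Seq (Do (IInc reg_t)) (Do (FCopy (ij arr_t) E))))"

text \<open>The shifted array is built in \<open>arr_t\<close> and copied back, because an ascending
  loop in place would overwrite entries of an insertion before they are read.\<close>

definition shift_array :: "com \<Rightarrow> nat \<Rightarrow> com" where
  "shift_array c a = Seq (for2 M N c) (copy a M N (ij arr_t))"

lemma runs_shift_array:
  assumes "\<And>i j s. i < m \<Longrightarrow> j < n \<Longrightarrow> agree_off {reg_i, reg_j, reg_t} {arr_t} s0 s \<Longrightarrow>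
      regs s reg_i = i \<Longrightarrow> regs s reg_j = j \<Longrightarrow>
      runs \<omega> 5 c s (\<lambda>s'. agree_off {reg_t} {arr_t} s s' \<and>
        mem s' arr_t = (mem s arr_t)(i := (mem s arr_t i)(j := f i j)))"
    and "regs s0 reg_m = m" "regs s0 reg_n = n" "a \<noteq> arr_t" "Suc m * Suc n \<le> W"
  shows "runs \<omega> (18 * W) (shift_array c a) s0 (\<lambda>s'. agree_off {reg_i, reg_j, reg_t} {a, arr_t} s0 s' \<and>
    (\<forall>i<m. \<forall>j<n. mem s' a i j = f i j))"
  unfolding shift_array_def
proof (rule runs_Seq)
  show "runs \<omega> ((5 + 6) * W) (for2 M N c) s0 (\<lambda>s'. agree_off {reg_i, reg_j, reg_t} {arr_t} s0 s' \<and>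
    (\<forall>x y. mem s' arr_t x y = (if x < m \<and> y < n then f x y else mem s0 arr_t x y)))"
    by (rule runs_fill) (use assms in auto)
  show "(5 + 6) * W \<le> 18 * W" by simp
next
  fix s1 assume s1: "agree_off {reg_i, reg_j, reg_t} {arr_t} s0 s1 \<and>
    (\<forall>x y. mem s1 arr_t x y = (if x < m \<and> y < n then f x y else mem s0 arr_t x y))"
  show "runs \<omega> (18 * W - (5 + 6) * W) (copy a M N (ij arr_t)) s1
      (\<lambda>s'. agree_off {reg_i, reg_j, reg_t} {a, arr_t} s0 s' \<and> (\<forall>i<m. \<forall>j<n. mem s' a i j = f i j))"
    by (rule runs_mono, rule runs_copy[where W = W]) (use s1 assms in \<open>auto simp: agree_off_def\<close>)
qed

definition insert_zero :: "nat \<Rightarrow> nat \<Rightarrow> (nat \<Rightarrow> 'a::zero) \<Rightarrow> 'a" where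
  "insert_zero p i F = (if i < p then F i else if i = p then 0 else F (i - 1))"

text \<open>As in the three programs after it, the dimension changes first, so that the loops run
  over the rectangle of the new matrix.\<close>

definition insert_row :: com where
  "insert_row = seqs [Do (IInc reg_m),
     shift_array (insert_body reg_i (Cell arr_A (Reg reg_t) (Reg reg_j))) arr_A,
     shift_array (insert_body reg_i (Cell arr_Y (Reg reg_t) (Reg reg_j))) arr_Y]"

definition insert_col :: com where
  "insert_col = seqs [Do (IInc reg_n),
     shift_array (insert_body reg_j (Cell arr_A (Reg reg_i) (Reg reg_t))) arr_A,
     shift_array (insert_body reg_j (Cell arr_Y (Reg reg_i) (Reg reg_t))) arr_Y]"

definition delete_row :: com where
  "delete_row = seqs [Do (IDec reg_m),
     shift_array (delete_body reg_i (Cell arr_A (Reg reg_t) (Reg reg_j))) arr_A,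
     shift_array (delete_body reg_i (Cell arr_Y (Reg reg_t) (Reg reg_j))) arr_Y]"

definition delete_col :: com where
  "delete_col = seqs [Do (IDec reg_n),
     shift_array (delete_body reg_j (Cell arr_A (Reg reg_i) (Reg reg_t))) arr_A,
     shift_array (delete_body reg_j (Cell arr_Y (Reg reg_i) (Reg reg_t))) arr_Y]"

lemma runs_insert_body_row:
  assumes "agree_off {reg_i, reg_j, reg_t} {arr_t} s0 s" "regs s reg_i = i" "regs s reg_j = j" "a \<noteq> arr_t"
  shows "runs \<omega> 5 (insert_body reg_i (Cell a (Reg reg_t) (Reg reg_j))) s
    (\<lambda>s'. agree_off {reg_t} {arr_t} s s' \<and>
      mem s' arr_t = (mem s arr_t)(i := (mem s arr_t i)(j := insert_zero (regs s0 0) i (\<lambda>k. mem s0 a k j))))"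
  unfolding insert_body_def using assms
  by (intro runs_Seq_Do runs_Cond runs_Do)
    (auto simp: agree_off_def set_reg_def insert_zero_def)

lemma runs_insert_body_col:
  assumes "agree_off {reg_i, reg_j, reg_t} {arr_t} s0 s" "regs s reg_i = i" "regs s reg_j = j" "a \<noteq> arr_t"
  shows "runs \<omega> 5 (insert_body reg_j (Cell a (Reg reg_i) (Reg reg_t))) s
    (\<lambda>s'. agree_off {reg_t} {arr_t} s s' \<and>
      mem s' arr_t = (mem s arr_t)(i := (mem s arr_t i)(j := insert_zero (regs s0 0) j (mem s0 a i))))"
  unfolding insert_body_def using assms
  by (intro runs_Seq_Do runs_Cond runs_Do)
    (auto simp: agree_off_def set_reg_def insert_zero_def)

lemma runs_delete_body_row:
  assumes "agree_off {reg_i, reg_j, reg_t} {arr_t} s0 s" "regs s reg_i = i" "regs s reg_j = j" "a \<noteq> arr_t"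
  shows "runs \<omega> 5 (delete_body reg_i (Cell a (Reg reg_t) (Reg reg_j))) s
    (\<lambda>s'. agree_off {reg_t} {arr_t} s s' \<and>
      mem s' arr_t = (mem s arr_t)(i := (mem s arr_t i)(j := mem s0 a (skip (regs s0 0) i) j)))"
  unfolding delete_body_def using assms
  by (intro runs_Seq_Do runs_Cond runs_Do)
    (auto simp: agree_off_def set_reg_def skip_def)

lemma runs_delete_body_col:
  assumes "agree_off {reg_i, reg_j, reg_t} {arr_t} s0 s" "regs s reg_i = i" "regs s reg_j = j" "a \<noteq> arr_t"
  shows "runs \<omega> 5 (delete_body reg_j (Cell a (Reg reg_i) (Reg reg_t))) s
    (\<lambda>s'. agree_off {reg_t} {arr_t} s s' \<and>
      mem s' arr_t = (mem s arr_t)(i := (mem s arr_t i)(j := mem s0 a i (skip (regs s0 0) j))))"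
  unfolding delete_body_def using assms
  by (intro runs_Seq_Do runs_Cond runs_Do)
    (auto simp: agree_off_def set_reg_def skip_def)

lemma runs_shift_insert_row:
  assumes "regs s reg_m = m" "regs s reg_n = n" "a \<noteq> arr_t" "Suc m * Suc n \<le> W"
  shows "runs \<omega> (18 * W) (shift_array (insert_body reg_i (Cell a (Reg reg_t) (Reg reg_j))) a) s
    (\<lambda>s'. agree_off {reg_i, reg_j, reg_t} {a, arr_t} s s' \<and>
      (\<forall>i<m. \<forall>j<n. mem s' a i j = insert_zero (regs s 0) i (\<lambda>k. mem s a k j)))"
  by (rule runs_shift_array[OF runs_insert_body_row]) (use assms in auto)

lemma runs_shift_insert_col:
  assumes "regs s reg_m = m" "regs s reg_n = n" "a \<noteq> arr_t" "Suc m * Suc n \<le> W"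
  shows "runs \<omega> (18 * W) (shift_array (insert_body reg_j (Cell a (Reg reg_i) (Reg reg_t))) a) s
    (\<lambda>s'. agree_off {reg_i, reg_j, reg_t} {a, arr_t} s s' \<and>
      (\<forall>i<m. \<forall>j<n. mem s' a i j = insert_zero (regs s 0) j (mem s a i)))"
  by (rule runs_shift_array[OF runs_insert_body_col]) (use assms in auto)

lemma runs_shift_delete_row:
  assumes "regs s reg_m = m" "regs s reg_n = n" "a \<noteq> arr_t" "Suc m * Suc n \<le> W"
  shows "runs \<omega> (18 * W) (shift_array (delete_body reg_i (Cell a (Reg reg_t) (Reg reg_j))) a) s
    (\<lambda>s'. agree_off {reg_i, reg_j, reg_t} {a, arr_t} s s' \<and>
      (\<forall>i<m. \<forall>j<n. mem s' a i j = mem s a (skip (regs s 0) i) j))"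
  by (rule runs_shift_array[OF runs_delete_body_row]) (use assms in auto)

lemma runs_shift_delete_col:
  assumes "regs s reg_m = m" "regs s reg_n = n" "a \<noteq> arr_t" "Suc m * Suc n \<le> W"
  shows "runs \<omega> (18 * W) (shift_array (delete_body reg_j (Cell a (Reg reg_i) (Reg reg_t))) a) s
    (\<lambda>s'. agree_off {reg_i, reg_j, reg_t} {a, arr_t} s s' \<and>
      (\<forall>i<m. \<forall>j<n. mem s' a i j = mem s a i (skip (regs s 0) j)))"
  by (rule runs_shift_array[OF runs_delete_body_col]) (use assms in auto)

lemma insert_zero_skip [simp]: "insert_zero p (skip p i) F = F i"
  and insert_zero_same [simp]: "insert_zero p p F = 0"
  by (auto simp: insert_zero_def skip_def)

section \<open>Insertion and deletion of zero rows and columns preserve the invariant\<close>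

lemma runs_insert_row:
  assumes s: "represents m n s" and p: "regs s 0 = p" "p \<le> m"
  shows "runs \<omega> (37 * (Suc (Suc m) * Suc n)) insert_row s (\<lambda>s'. represents (Suc m) n s' \<and>
    agree_off {reg_m, reg_i, reg_j, reg_t} {arr_A, arr_Y, arr_t} s s' \<and>
    (\<forall>i<m. \<forall>j<n. mem s' arr_A (skip p i) j = mem s arr_A i j) \<and> (\<forall>j<n. mem s' arr_A p j = 0))"
proof -
  define W where "W = Suc (Suc m) * Suc n"
  have mn: "regs s reg_m = m" "regs s reg_n = n" using s by (auto simp: represents_def)
  have "runs \<omega> (37 * W) insert_row s (\<lambda>s'. regs s' reg_m = Suc m \<and>
    agree_off {reg_m, reg_i, reg_j, reg_t} {arr_A, arr_Y, arr_t} s s' \<and>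
    (\<forall>i<Suc m. \<forall>j<n. mem s' arr_A i j = insert_zero p i (\<lambda>k. mem s arr_A k j)) \<and>
    (\<forall>i<Suc m. \<forall>j<n. mem s' arr_Y i j = insert_zero p i (\<lambda>k. mem s arr_Y k j)))"
    unfolding insert_row_def seqs.simps
    apply (rule runs_Seq_Do, (simp add: W_def; fail))
    apply (rule runs_Seq, rule runs_shift_insert_row[where W = W and m = "Suc m" and n = n], (simp add: mn W_def set_reg_def; fail)+)
    apply (rule runs_mono, rule runs_shift_insert_row[where W = W and m = "Suc m" and n = n], (simp add: mn W_def set_reg_def agree_off_def; fail)+)
    apply (simp add: mn p set_reg_def agree_off_def)
    done
  then show ?thesis
    unfolding W_def
  proof (rule runs_mono[OF _ order_refl], elim conjE)
    fix s' assume P: "regs s' reg_m = Suc m" "agree_off {reg_m, reg_i, reg_j, reg_t} {arr_A, arr_Y, arr_t} s s'"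
      "\<forall>i<Suc m. \<forall>j<n. mem s' arr_A i j = insert_zero p i (\<lambda>k. mem s arr_A k j)"
      "\<forall>i<Suc m. \<forall>j<n. mem s' arr_Y i j = insert_zero p i (\<lambda>k. mem s arr_Y k j)"
    have R: "row_extension m n p (mem s arr_A) (mem s' arr_A)"
      using P p by (simp add: row_extension_def skip_less)
    have "represents (Suc m) n s'"
      using P s row_extension_fun_rank[OF R] row_extension_ginv[OF R, of "mem s' arr_Y" "mem s arr_Y"]
      by (simp add: represents_def agree_off_def skip_less)
    then show "represents (Suc m) n s' \<and>
      agree_off {reg_m, reg_i, reg_j, reg_t} {arr_A, arr_Y, arr_t} s s' \<and>
      (\<forall>i<m. \<forall>j<n. mem s' arr_A (skip p i) j = mem s arr_A i j) \<and> (\<forall>j<n. mem s' arr_A p j = 0)"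
      using P R by (simp add: row_extension_def)
  qed
qed


text \<open>The facts on row extensions are applied to the transposed arrays.\<close>

lemma runs_insert_col:
  assumes s: "represents m n s" and p: "regs s 0 = p" "p \<le> n"
  shows "runs \<omega> (37 * (Suc m * Suc (Suc n))) insert_col s (\<lambda>s'. represents m (Suc n) s' \<and>
    agree_off {reg_n, reg_i, reg_j, reg_t} {arr_A, arr_Y, arr_t} s s' \<and>
    (\<forall>j<n. \<forall>i<m. mem s' arr_A i (skip p j) = mem s arr_A i j) \<and> (\<forall>i<m. mem s' arr_A i p = 0))"
proof -
  define W where "W = Suc m * Suc (Suc n)"
  have mn: "regs s reg_m = m" "regs s reg_n = n" using s by (auto simp: represents_def)
  have "runs \<omega> (37 * W) insert_col s (\<lambda>s'. regs s' reg_n = Suc n \<and>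
    agree_off {reg_n, reg_i, reg_j, reg_t} {arr_A, arr_Y, arr_t} s s' \<and>
    (\<forall>i<m. \<forall>j<Suc n. mem s' arr_A i j = insert_zero p j (mem s arr_A i)) \<and>
    (\<forall>i<m. \<forall>j<Suc n. mem s' arr_Y i j = insert_zero p j (mem s arr_Y i)))"
    unfolding insert_col_def seqs.simps
    apply (rule runs_Seq_Do, (simp add: W_def; fail))
    apply (rule runs_Seq, rule runs_shift_insert_col[where W = W and m = m and n = "Suc n"], (simp add: mn W_def set_reg_def; fail)+)
    apply (rule runs_mono, rule runs_shift_insert_col[where W = W and m = m and n = "Suc n"], (simp add: mn W_def set_reg_def agree_off_def; fail)+)
    apply (simp add: mn p set_reg_def agree_off_def)
    done
  then show ?thesis
    unfolding W_def
  proof (rule runs_mono[OF _ order_refl], elim conjE)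
    fix s' assume P: "regs s' reg_n = Suc n" "agree_off {reg_n, reg_i, reg_j, reg_t} {arr_A, arr_Y, arr_t} s s'"
      "\<forall>i<m. \<forall>j<Suc n. mem s' arr_A i j = insert_zero p j (mem s arr_A i)"
      "\<forall>i<m. \<forall>j<Suc n. mem s' arr_Y i j = insert_zero p j (mem s arr_Y i)"
    have R: "row_extension n m p (\<lambda>i j. mem s arr_A j i) (\<lambda>i j. mem s' arr_A j i)"
      using P p by (simp add: row_extension_def skip_less)
    have "represents m (Suc n) s'"
      using P s row_extension_fun_rank[OF R]
        row_extension_ginv[OF R, of "\<lambda>i j. mem s' arr_Y j i" "\<lambda>i j. mem s arr_Y j i"]
      unfolding fun_rank_transpose[of _ m] ginv_transpose[of _ m]
      by (simp add: represents_def agree_off_def skip_less)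
    then show "represents m (Suc n) s' \<and>
      agree_off {reg_n, reg_i, reg_j, reg_t} {arr_A, arr_Y, arr_t} s s' \<and>
      (\<forall>j<n. \<forall>i<m. mem s' arr_A i (skip p j) = mem s arr_A i j) \<and> (\<forall>i<m. mem s' arr_A i p = 0)"
      using P R by (simp add: row_extension_def)
  qed
qed

text \<open>Hypothesis \<open>0\<close> is arranged by a preceding rank one update that clears row
  \<open>p\<close>; the old matrix is then a row extension of the new one.\<close>

lemma runs_delete_row:
  assumes s: "represents (Suc m) n s" and p: "regs s 0 = p" "p \<le> m" and 0: "\<And>j. j < n \<Longrightarrow> mem s arr_A p j = 0"
  shows "runs \<omega> (37 * (Suc m * Suc n)) delete_row s (\<lambda>s'. represents m n s' \<and>
    (\<forall>i<m. \<forall>j<n. mem s' arr_A i j = mem s arr_A (skip p i) j))"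
proof -
  define W where "W = Suc m * Suc n"
  have mn: "regs s reg_m = Suc m" "regs s reg_n = n" using s by (auto simp: represents_def)
  have "runs \<omega> (37 * W) delete_row s (\<lambda>s'. regs s' reg_m = m \<and>
    agree_off {reg_m, reg_i, reg_j, reg_t} {arr_A, arr_Y, arr_t} s s' \<and>
    (\<forall>i<m. \<forall>j<n. mem s' arr_A i j = mem s arr_A (skip p i) j) \<and>
    (\<forall>i<m. \<forall>j<n. mem s' arr_Y i j = mem s arr_Y (skip p i) j))"
    unfolding delete_row_def seqs.simps
    apply (rule runs_Seq_Do, (simp add: W_def; fail))
    apply (rule runs_Seq, rule runs_shift_delete_row[where W = W and m = m and n = n], (simp add: mn W_def set_reg_def; fail)+)
    apply (rule runs_mono, rule runs_shift_delete_row[where W = W and m = m and n = n], (simp add: mn W_def set_reg_def agree_off_def; fail)+)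
    apply (simp add: mn p set_reg_def agree_off_def)
    done
  then show ?thesis
    unfolding W_def
  proof (rule runs_mono[OF _ order_refl], elim conjE)
    fix s' assume P: "regs s' reg_m = m" "agree_off {reg_m, reg_i, reg_j, reg_t} {arr_A, arr_Y, arr_t} s s'"
      "\<forall>i<m. \<forall>j<n. mem s' arr_A i j = mem s arr_A (skip p i) j"
      "\<forall>i<m. \<forall>j<n. mem s' arr_Y i j = mem s arr_Y (skip p i) j"
    have R: "row_extension m n p (mem s' arr_A) (mem s arr_A)"
      using P p 0 by (simp add: row_extension_def)
    have "represents m n s'"
      using P s row_extension_fun_rank[OF R] row_extension_ginv[OF R, of "mem s arr_Y" "mem s' arr_Y"]
      by (simp add: represents_def agree_off_def)
    then show "represents m n s' \<and> (\<forall>i<m. \<forall>j<n. mem s' arr_A i j = mem s arr_A (skip p i) j)"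
      using P by simp
  qed
qed

lemma runs_delete_col:
  assumes s: "represents m (Suc n) s" and p: "regs s 0 = p" "p \<le> n" and 0: "\<And>i. i < m \<Longrightarrow> mem s arr_A i p = 0"
  shows "runs \<omega> (37 * (Suc m * Suc n)) delete_col s (\<lambda>s'. represents m n s' \<and>
    (\<forall>i<m. \<forall>j<n. mem s' arr_A i j = mem s arr_A i (skip p j)))"
proof -
  define W where "W = Suc m * Suc n"
  have mn: "regs s reg_m = m" "regs s reg_n = Suc n" using s by (auto simp: represents_def)
  have "runs \<omega> (37 * W) delete_col s (\<lambda>s'. regs s' reg_n = n \<and>
    agree_off {reg_n, reg_i, reg_j, reg_t} {arr_A, arr_Y, arr_t} s s' \<and>
    (\<forall>i<m. \<forall>j<n. mem s' arr_A i j = mem s arr_A i (skip p j)) \<and>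
    (\<forall>i<m. \<forall>j<n. mem s' arr_Y i j = mem s arr_Y i (skip p j)))"
    unfolding delete_col_def seqs.simps
    apply (rule runs_Seq_Do, (simp add: W_def; fail))
    apply (rule runs_Seq, rule runs_shift_delete_col[where W = W and m = m and n = n], (simp add: mn W_def set_reg_def; fail)+)
    apply (rule runs_mono, rule runs_shift_delete_col[where W = W and m = m and n = n], (simp add: mn W_def set_reg_def agree_off_def; fail)+)
    apply (simp add: mn p set_reg_def agree_off_def)
    done
  then show ?thesis
    unfolding W_def
  proof (rule runs_mono[OF _ order_refl], elim conjE)
    fix s' assume P: "regs s' reg_n = n" "agree_off {reg_n, reg_i, reg_j, reg_t} {arr_A, arr_Y, arr_t} s s'"
      "\<forall>i<m. \<forall>j<n. mem s' arr_A i j = mem s arr_A i (skip p j)"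
      "\<forall>i<m. \<forall>j<n. mem s' arr_Y i j = mem s arr_Y i (skip p j)"
    have R: "row_extension n m p (\<lambda>i j. mem s' arr_A j i) (\<lambda>i j. mem s arr_A j i)"
      using P p 0 by (simp add: row_extension_def)
    have "represents m n s'"
      using P s row_extension_fun_rank[OF R]
        row_extension_ginv[OF R, of "\<lambda>i j. mem s arr_Y j i" "\<lambda>i j. mem s' arr_Y j i"]
      unfolding fun_rank_transpose[of _ m] ginv_transpose[of _ m]
      by (simp add: represents_def agree_off_def)
    then show "represents m n s' \<and> (\<forall>i<m. \<forall>j<n. mem s' arr_A i j = mem s arr_A i (skip p j))"
      using P by simp
  qed
qed

section \<open>The programs\<close>

definition answer :: com where
  "answer = Do (IMove 0 (Reg reg_rank))"

definition rank_one_program :: com where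
  "rank_one_program = Seq rank_one answer"

text \<open>The new row arrives in the array of \<open>u\<close>. It is moved to \<open>v\<close>,
  and \<open>u\<close> becomes the unit vector of its position, so that the rank one update fills
  the inserted zero row.\<close>

definition add_row_program :: com where
  "add_row_program = seqs [insert_row, copy arr_v N (Const 1) (ij arr_u), clear arr_u M,
     Do (FOne (Cell arr_u (Reg 0) (Const 0))), rank_one, answer]"

definition add_col_program :: com where
  "add_col_program = seqs [insert_col, clear arr_v N,
     Do (FOne (Cell arr_v (Reg 0) (Const 0))), rank_one, answer]"

text \<open>\<open>u\<close> is the unit vector of the row and \<open>v\<close> the negated row, so
  the rank one update clears it. The second factor of the accumulation is the entry 1 of
  \<open>u\<close>, which makes it a negated copy.\<close>

definition delete_row_program :: com where
  "delete_row_program = seqs [clear arr_u M, Do (FOne (Cell arr_u (Reg 0) (Const 0))), clear arr_v N,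
     accumulate True N (Const 1) (at_i arr_v) (Cell arr_A (Reg 0) (Reg reg_i)) (Cell arr_u (Reg 0) (Const 0)),
     rank_one, delete_row, answer]"

definition delete_col_program :: com where
  "delete_col_program = seqs [clear arr_v N, Do (FOne (Cell arr_v (Reg 0) (Const 0))), clear arr_u M,
     accumulate True M (Const 1) (at_i arr_u) (Cell arr_A (Reg reg_i) (Reg 0)) (Cell arr_v (Reg 0) (Const 0)),
     rank_one, delete_col, answer]"

text \<open>Round \<open>k\<close> adds row \<open>k\<close> of the input by a rank one update with
  a unit vector.\<close>

definition init_body :: com where
  "init_body = seqs [clear arr_u M, Do (FOne (Cell arr_u (Reg reg_k) (Const 0))),
     copy arr_v N (Const 1) (Cell 0 (Reg reg_k) (Reg reg_i)), rank_one]"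

definition init_program :: com where
  "init_program = seqs [Do (IMove reg_m (Reg 0)), Do (IMove reg_n (Reg 1)), for_loop reg_k M init_body, answer]"

definition algorithm :: dyn_algorithm where
  "algorithm = \<lparr>prog_init = init_program, prog_rank_one = rank_one_program,
     prog_add_row = add_row_program, prog_delete_row = delete_row_program,
     prog_add_col = add_col_program, prog_delete_col = delete_col_program\<rparr>"

definition finished :: "nat \<Rightarrow> nat \<Rightarrow> 'k::field state \<Rightarrow> bool" where
  "finished m n s \<longleftrightarrow> represents m n s \<and> regs s 0 = regs s reg_rank"

lemma runs_answer:
  assumes "represents m n s" "1 \<le> T" and "\<And>s'. finished m n s' \<Longrightarrow> mem s' = mem s \<Longrightarrow> Q s'"
  shows "runs \<omega> T answer s Q"
  unfolding answer_def
proof (rule runs_Do)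
  show "Q (exec_instr \<omega> (IMove 0 (Reg reg_rank)) s)"
    by (rule assms(3)) (use assms(1) in \<open>auto simp: finished_def represents_def set_reg_def\<close>)
qed fact

lemma represents_agree_off:
  assumes "represents m n s" "agree_off R D s s'" "{reg_m, reg_n, reg_rank} \<inter> R = {}" "{arr_A, arr_Y} \<inter> D = {}"
  shows "represents m n s'"
  using assms by (simp add: represents_def agree_off_def)

lemma runs_rank_one_program:
  assumes s: "represents m n s"
  shows "runs \<omega> (501 * (Suc m * Suc n)) rank_one_program s (\<lambda>s'. finished m n s' \<and>
    (\<forall>i<m. \<forall>j<n. mem s' arr_A i j = mem s arr_A i j + mem s arr_u i 0 * mem s arr_v j 0))"
  unfolding rank_one_program_def
  apply (rule runs_Seq, rule runs_rank_one[OF s], (simp; fail))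
  apply (rule runs_answer[where m = "m" and n = "n"], simp_all)
  done

lemma runs_add_row_program:
  assumes s: "represents m n s" and p: "regs s 0 = p" "p \<le> m"
  shows "runs \<omega> (600 * (Suc (Suc m) * Suc n)) add_row_program s (\<lambda>s'. finished (Suc m) n s' \<and>
    (\<forall>i<m. \<forall>j<n. mem s' arr_A (skip p i) j = mem s arr_A i j) \<and>
    (\<forall>j<n. mem s' arr_A p j = mem s arr_u j 0))"
proof -
  define W where "W = Suc (Suc m) * Suc n"
  have W: "1 \<le> W" by (simp add: W_def)
  have mn: "regs s reg_m = m" "regs s reg_n = n" using s by (auto simp: represents_def)
  have rank_one: "runs \<omega> (500 * W) rank_one s (\<lambda>s'. represents (Suc m) n s' \<and>
    (\<forall>i<Suc m. \<forall>j<n. mem s' arr_A i j = mem s arr_A i j + mem s arr_u i 0 * mem s arr_v j 0))"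
    if "represents (Suc m) n s" for s :: "'a state"
    by (rule runs_mono[OF runs_rank_one[OF that]]) (simp_all add: W_def)
  show ?thesis
    unfolding add_row_program_def seqs.simps W_def[symmetric]
    apply (rule runs_Seq, rule runs_insert_row[OF s p, folded W_def], (simp; fail))
    apply (rule runs_Seq, rule runs_copy[where W = "2 * W"],
        (simp add: mn agree_off_def represents_def W_def; fail)+)
    apply (rule runs_Seq, rule runs_clear[where W = "2 * W"],
        (simp add: mn agree_off_def represents_def W_def; fail)+)
    apply (rule runs_Seq_Do, (use W in simp; fail))
    apply (rule runs_Seq, rule rank_one)
      apply (elim conjE, erule represents_agree_off[where R = "{reg_i, reg_j, reg_t}" and D = "{arr_u, arr_v}"],
        (simp add: agree_off_def; fail)+)
    apply (rule runs_answer[where m = "Suc m" and n = "n"], (simp; fail), (use W in \<open>simp add: W_def\<close>; fail))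
    apply (use p skip_neq[of p] in \<open>simp add: mn agree_off_def represents_def skip_less\<close>)
    done
qed

lemma runs_add_col_program:
  assumes s: "represents m n s" and p: "regs s 0 = p" "p \<le> n"
  shows "runs \<omega> (600 * (Suc m * Suc (Suc n))) add_col_program s (\<lambda>s'. finished m (Suc n) s' \<and>
    (\<forall>i<m. \<forall>j<n. mem s' arr_A i (skip p j) = mem s arr_A i j) \<and>
    (\<forall>i<m. mem s' arr_A i p = mem s arr_u i 0))"
proof -
  define W where "W = Suc m * Suc (Suc n)"
  have W: "1 \<le> W" by (simp add: W_def)
  have mn: "regs s reg_m = m" "regs s reg_n = n" using s by (auto simp: represents_def)
  have rank_one: "runs \<omega> (500 * W) rank_one s (\<lambda>s'. represents m (Suc n) s' \<and>
    (\<forall>i<m. \<forall>j<Suc n. mem s' arr_A i j = mem s arr_A i j + mem s arr_u i 0 * mem s arr_v j 0))"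
    if "represents m (Suc n) s" for s :: "'a state"
    by (rule runs_mono[OF runs_rank_one[OF that]]) (simp_all add: W_def)
  show ?thesis
    unfolding add_col_program_def seqs.simps W_def[symmetric]
    apply (rule runs_Seq, rule runs_insert_col[OF s p, folded W_def], (simp; fail))
    apply (rule runs_Seq, rule runs_clear[where W = "2 * W"],
        (simp add: mn agree_off_def represents_def W_def; fail)+)
    apply (rule runs_Seq_Do, (use W in simp; fail))
    apply (rule runs_Seq, rule rank_one)
      apply (elim conjE, erule represents_agree_off[where R = "{reg_i, reg_j, reg_t}" and D = "{arr_v}"],
        (simp add: agree_off_def; fail)+)
    apply (rule runs_answer[where m = "m" and n = "Suc n"], (simp; fail), (use W in \<open>simp add: W_def\<close>; fail))
    apply (use p skip_neq[of p] in \<open>simp add: mn agree_off_def represents_def skip_less\<close>)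
    done
qed

lemma runs_delete_row_program:
  assumes s: "represents (Suc m) n s" and p: "regs s 0 = p" "p \<le> m"
  shows "runs \<omega> (600 * (Suc (Suc m) * Suc n)) delete_row_program s (\<lambda>s'. finished m n s' \<and>
    (\<forall>i<m. \<forall>j<n. mem s' arr_A i j = mem s arr_A (skip p i) j))"
proof -
  define W where "W = Suc (Suc m) * Suc n"
  have W: "1 \<le> W" by (simp add: W_def)
  have mn: "regs s reg_m = Suc m" "regs s reg_n = n" using s by (auto simp: represents_def)
  have rank_one: "runs \<omega> (500 * W) rank_one s (\<lambda>s'. represents (Suc m) n s' \<and> regs s' 0 = regs s 0 \<and>
    (\<forall>i<Suc m. \<forall>j<n. mem s' arr_A i j = mem s arr_A i j + mem s arr_u i 0 * mem s arr_v j 0))"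
    if "represents (Suc m) n s" for s :: "'a state"
    by (rule runs_mono[OF runs_rank_one[OF that]]) (simp_all add: W_def)
  show ?thesis
    unfolding delete_row_program_def seqs.simps W_def[symmetric]
    apply (rule runs_Seq, rule runs_clear[where W = "2 * W"], (simp add: mn W_def; fail)+)
    apply (rule runs_Seq_Do, (use W in simp; fail))
    apply (rule runs_Seq, rule runs_clear[where W = "2 * W"], (simp add: mn agree_off_def W_def; fail)+)
    apply (rule runs_Seq, rule runs_accumulate_row[where W = "2 * W"],
        (simp add: mn agree_off_def W_def; fail)+)
    apply (rule runs_Seq, rule rank_one)
      apply (rule represents_agree_off[OF s, where R = "{reg_i, reg_j, reg_t}" and D = "{arr_u, arr_v, tmp_array}"],
        (simp add: agree_off_def; fail)+)
    apply (rule runs_Seq, rule runs_delete_row[where p = p], blast)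
        apply (use p in \<open>simp add: mn agree_off_def\<close>; fail)+
     apply (simp add: W_def; fail)
    apply (rule runs_answer[where m = "m" and n = "n"], (simp; fail), (use W in \<open>simp add: W_def\<close>; fail))
    apply (use p skip_neq[of p] in \<open>simp add: mn agree_off_def skip_less\<close>)
    done
qed

lemma runs_delete_col_program:
  assumes s: "represents m (Suc n) s" and p: "regs s 0 = p" "p \<le> n"
  shows "runs \<omega> (600 * (Suc m * Suc (Suc n))) delete_col_program s (\<lambda>s'. finished m n s' \<and>
    (\<forall>i<m. \<forall>j<n. mem s' arr_A i j = mem s arr_A i (skip p j)))"
proof -
  define W where "W = Suc m * Suc (Suc n)"
  have W: "1 \<le> W" by (simp add: W_def)
  have mn: "regs s reg_m = m" "regs s reg_n = Suc n" using s by (auto simp: represents_def)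
  have rank_one: "runs \<omega> (500 * W) rank_one s (\<lambda>s'. represents m (Suc n) s' \<and> regs s' 0 = regs s 0 \<and>
    (\<forall>i<m. \<forall>j<Suc n. mem s' arr_A i j = mem s arr_A i j + mem s arr_u i 0 * mem s arr_v j 0))"
    if "represents m (Suc n) s" for s :: "'a state"
    by (rule runs_mono[OF runs_rank_one[OF that]]) (simp_all add: W_def)
  show ?thesis
    unfolding delete_col_program_def seqs.simps W_def[symmetric]
    apply (rule runs_Seq, rule runs_clear[where W = "2 * W"], (simp add: mn W_def; fail)+)
    apply (rule runs_Seq_Do, (use W in simp; fail))
    apply (rule runs_Seq, rule runs_clear[where W = "2 * W"], (simp add: mn agree_off_def W_def; fail)+)
    apply (rule runs_Seq, rule runs_accumulate_row[where W = "2 * W"],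
        (simp add: mn agree_off_def W_def; fail)+)
    apply (rule runs_Seq, rule rank_one)
      apply (rule represents_agree_off[OF s, where R = "{reg_i, reg_j, reg_t}" and D = "{arr_u, arr_v, tmp_array}"],
        (simp add: agree_off_def; fail)+)
    apply (rule runs_Seq, rule runs_delete_col[where p = p], blast)
        apply (use p in \<open>simp add: mn agree_off_def\<close>; fail)+
     apply (simp add: W_def; fail)
    apply (rule runs_answer[where m = "m" and n = "n"], (simp; fail), (use W in \<open>simp add: W_def\<close>; fail))
    apply (use p skip_neq[of p] in \<open>simp add: mn agree_off_def skip_less\<close>)
    done
qed

section \<open>Initialisation from the zero matrix, one rank one update per row\<close>

lemma ginv_zero: "ginv m n (\<lambda>_ _. 0) Y"
  by (simp add: ginv_def)

lemma fun_rank_zero: "fun_rank m n (\<lambda>_ _. 0) = 0"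
  using fun_rank_leI[where I = "{}" and A = "\<lambda>_ _. 0 :: 'a" and r = 0 and m = m and n = n] by simp

text \<open>The zero matrix has rank 0 and every matrix as a generalised inverse, so the invariant
  holds at the start; \<open>J k\<close> describes the state after \<open>k\<close> rows.\<close>

lemma runs_init_program:
  assumes s: "regs s 0 = m" "regs s 1 = n" "regs s reg_rank = 0" "mem s arr_A = (\<lambda>_ _. 0)"
  shows "runs \<omega> ((m + n + 2) ^ 13) init_program s (\<lambda>s'. finished m n s' \<and>
    (\<forall>i<m. \<forall>j<n. mem s' arr_A i j = mem s 0 i j))"
proof -
  define W where "W = 2 * (Suc m * Suc n)"
  have W: "1 \<le> W" by (simp add: W_def)
  define J where "J k s' \<longleftrightarrow> represents m n s' \<and> mem s' 0 = mem s 0 \<and>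
    (\<forall>i<m. \<forall>j<n. mem s' arr_A i j = (if i < k then mem s 0 i j else 0))" for k s'
  have rank_one: "runs \<omega> (250 * W) rank_one s (\<lambda>s'. represents m n s' \<and>
      regs s' reg_k = regs s reg_k \<and> mem s' 0 = mem s 0 \<and>
      (\<forall>i<m. \<forall>j<n. mem s' arr_A i j = mem s arr_A i j + mem s arr_u i 0 * mem s arr_v j 0))"
    if "represents m n s" for s :: "'a state"
    by (rule runs_mono[OF runs_rank_one[OF that]]) (simp_all add: W_def)
  have init: "represents m n (set_reg reg_n n (set_reg reg_m m s))"
    using s by (simp add: represents_def set_reg_def ginv_zero fun_rank_zero)
  have "runs \<omega> (m * (265 * W + 2) + 2) (for_loop reg_k M init_body) (set_reg reg_n n (set_reg reg_m m s)) (J m)"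
  proof (rule runs_for_loop)
    fix k s' assume k: "k < m" and J: "J k s'" and r: "regs s' reg_k = k"
    have s': "represents m n s'" and mn: "regs s' reg_m = m" "regs s' reg_n = n"
      using J by (auto simp: J_def represents_def)
    show "runs \<omega> (265 * W) init_body s' (\<lambda>s'. J (Suc k) s' \<and> regs s' reg_k = k)"
      unfolding init_body_def seqs.simps
      apply (rule runs_Seq, rule runs_clear[where W = W], (simp add: mn W_def; fail)+)
      apply (rule runs_Seq_Do, (use W in simp; fail))
      apply (rule runs_Seq, rule runs_copy[where W = W], (simp add: mn agree_off_def W_def; fail)+)
      apply (rule runs_mono, rule rank_one)
        apply (rule represents_agree_off[OF s', where R = "{reg_i, reg_j, reg_t}" and D = "{arr_u, arr_v}"],
          (simp add: agree_off_def; fail)+)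
      apply (use r J in \<open>auto simp: mn agree_off_def J_def less_Suc_eq\<close>)
      done
  next
    show "J 0 (set_reg reg_n n (set_reg reg_m m s))"
      using init s by (simp add: J_def set_reg_def)
  qed (auto simp: J_def represents_def set_reg_def)
  note loop = this
  have "runs \<omega> (m * (265 * W + 2) + 5) init_program s (\<lambda>s'. finished m n s' \<and>
      (\<forall>i<m. \<forall>j<n. mem s' arr_A i j = mem s 0 i j))"
    unfolding init_program_def seqs.simps
    apply (rule runs_Seq_Do, simp)
    apply (rule runs_Seq_Do, simp)
    apply (rule runs_Seq, use loop s in \<open>simp add: set_reg_def\<close>, simp)
    apply (rule runs_answer[where m = "m" and n = "n"])
    apply (auto simp: J_def)
    done
  moreover have "m * (265 * W + 2) + 5 \<le> (m + n + 2) ^ 13"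
  proof -
    define x where "x = m + n + 2"
    have x: "2 \<le> x" "m \<le> x" "Suc m \<le> x" "Suc n \<le> x" by (auto simp: x_def)
    have "W \<le> 2 * (x * x)" unfolding W_def using x by (intro mult_le_mono) auto
    then have "m * (265 * W + 2) + 5 \<le> x * (265 * (2 * (x * x)) + 2) + 5"
      using x by (intro add_mono mult_le_mono) auto
    also have "\<dots> = 530 * (x * (x * x)) + 2 * x + 5" by (simp add: algebra_simps)
    \<comment> \<open>The constant goes into the exponent: as \<open>x \<ge> 2\<close>, it is at
      most \<open>x ^ 10\<close>, whence 13 = 10 + 3.\<close>
    also have "\<dots> \<le> 2 ^ 10 * (x * (x * x))"
    proof -
      have "1 * 1 \<le> x * x" using x by (intro mult_le_mono) auto
      then have "x * 1 \<le> x * (x * x)" by (intro mult_le_mono) auto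
      moreover define y where "y = x * (x * x)"
      ultimately show ?thesis using x unfolding y_def[symmetric] by simp
    qed
    also have "\<dots> \<le> x ^ 10 * (x * (x * x))" using x by (intro mult_le_mono power_mono) auto
    also have "\<dots> = x ^ 13" by (simp add: numeral_eq_Suc)
    finally show ?thesis by (simp add: x_def)
  qed
  ultimately show ?thesis by (rule runs_mono) simp
qed

section \<open>The updates over the base field\<close>

text \<open>Loading with values in the base field. Correctness is proved over that field, so the
  maintained number is the rank there and ranks over different fields need not be compared.\<close>

definition base_vec :: "nat \<Rightarrow> 'a::field vec \<Rightarrow> 'a state \<Rightarrow> 'a state" where
  "base_vec a v s = s\<lparr>mem := (mem s)(a := \<lambda>i j. if i < dim_vec v \<and> j = 0 then v $ i else 0)\<rparr>"

fun base_load :: "'a::field update \<Rightarrow> 'a state \<Rightarrow> 'a state" where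
  "base_load (Rank_One u v) s = base_vec 2 v (base_vec 1 u s)"
| "base_load (Add_Row i v) s = set_reg 0 i (base_vec 1 v s)"
| "base_load (Delete_Row i) s = set_reg 0 i s"
| "base_load (Add_Col j v) s = set_reg 0 j (base_vec 1 v s)"
| "base_load (Delete_Col j) s = set_reg 0 j s"

definition base_init :: "nat \<Rightarrow> 'a::field mat \<Rightarrow> 'a state" where
  "base_init Q A = \<lparr>regs = (\<lambda>_. 0)(0 := dim_row A, 1 := dim_col A, 2 := Q), idx = (\<lambda>_ _. 0),
     mem = (\<lambda>_ _ _. 0)(0 := \<lambda>i j. if i < dim_row A \<and> j < dim_col A then A $$ (i, j) else 0),
     drawn = 0\<rparr>"

definition stores :: "'a::field mat \<Rightarrow> 'a state \<Rightarrow> bool" where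
  "stores B s \<longleftrightarrow> finished (dim_row B) (dim_col B) s \<and>
     (\<forall>i<dim_row B. \<forall>j<dim_col B. mem s arr_A i j = B $$ (i, j))"

lemma stores_answer: "stores B s \<Longrightarrow> regs s 0 = mat_rank B"
  unfolding mat_rank_conv_fun_rank stores_def finished_def represents_def
  by (auto intro: fun_rank_cong)

lemma represents_base_vec: "a \<noteq> arr_A \<Longrightarrow> a \<noteq> arr_Y \<Longrightarrow> represents m n (base_vec a v s) \<longleftrightarrow> represents m n s"
  by (simp add: represents_def base_vec_def)

lemma represents_set_reg_0: "represents m n (set_reg 0 x s) \<longleftrightarrow> represents m n s"
  by (simp add: represents_def set_reg_def)

section \<open>Dimensions and entries of the updated matrices\<close>

lemma add_row_dim:
  assumes "i \<le> dim_row A"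
  shows "dim_row (apply_update A (Add_Row i v)) = Suc (dim_row A)"
    "dim_col (apply_update A (Add_Row i v)) = dim_col A"
  using assms by auto

lemma add_row_index:
  assumes "i \<le> dim_row A" "j < dim_col A"
  shows "apply_update A (Add_Row i v) $$ (i, j) = v $ j"
    "k < dim_row A \<Longrightarrow> apply_update A (Add_Row i v) $$ (skip i k, j) = A $$ (k, j)"
  using assms by (auto simp: mat_of_rows_index nth_append skip_def min_def rows_def nth_Cons')

lemma add_col_dim:
  assumes "j \<le> dim_col A"
  shows "dim_row (apply_update A (Add_Col j v)) = dim_row A"
    "dim_col (apply_update A (Add_Col j v)) = Suc (dim_col A)"
  using assms by auto

lemma add_col_index:
  assumes "j \<le> dim_col A" "i < dim_row A"
  shows "apply_update A (Add_Col j v) $$ (i, j) = v $ i"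
    "k < dim_col A \<Longrightarrow> apply_update A (Add_Col j v) $$ (i, skip j k) = A $$ (i, k)"
  using assms by (auto simp: mat_of_cols_index nth_append skip_def min_def cols_def nth_Cons')

lemma delete_row_dim:
  assumes "i < dim_row A"
  shows "Suc (dim_row (apply_update A (Delete_Row i))) = dim_row A"
    "dim_col (apply_update A (Delete_Row i)) = dim_col A"
  using assms by auto

lemma delete_row_index:
  assumes "i < dim_row A" "j < dim_col A" "k < dim_row (apply_update A (Delete_Row i))"
  shows "apply_update A (Delete_Row i) $$ (k, j) = A $$ (skip i k, j)"
  using assms by (auto simp: mat_of_rows_index nth_append skip_def min_def rows_def)

lemma delete_col_dim:
  assumes "j < dim_col A"
  shows "dim_row (apply_update A (Delete_Col j)) = dim_row A"
    "Suc (dim_col (apply_update A (Delete_Col j))) = dim_col A"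
  using assms by auto

lemma delete_col_index:
  assumes "j < dim_col A" "i < dim_row A" "k < dim_col (apply_update A (Delete_Col j))"
  shows "apply_update A (Delete_Col j) $$ (i, k) = A $$ (i, skip j k)"
  using assms by (auto simp: mat_of_cols_index nth_append skip_def min_def cols_def)

lemma rank_one_dim:
  "dim_row (apply_update A (Rank_One u v)) = dim_row A" "dim_col (apply_update A (Rank_One u v)) = dim_col A"
  by auto

lemma rank_one_index:
  "i < dim_row A \<Longrightarrow> j < dim_col A \<Longrightarrow> apply_update A (Rank_One u v) $$ (i, j) = A $$ (i, j) + u $ i * v $ j"
  by (simp add: scalar_prod_def mat_of_cols_index mat_of_rows_index)

text \<open>The quantity \<open>s\<close> of \<open>soft_mn\<close>, as a natural number.\<close>

definition padded_size :: "'a mat \<Rightarrow> nat" where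
  "padded_size B = max 1 (dim_row B) * max 1 (dim_col B)"

lemma stores_all_rows:
  assumes "p \<le> m" "\<And>j. j < n \<Longrightarrow> f p j = g p j" "\<And>i j. i < m \<Longrightarrow> j < n \<Longrightarrow> f (skip p i) j = g (skip p i) j"
  shows "i < Suc m \<Longrightarrow> j < n \<Longrightarrow> f i j = g i j"
  by (rule skip_cases[of i m p]) (use assms in auto)

lemma runs_update:
  assumes s: "stores B s" and u: "valid_update B u"
  shows "runs \<omega> (5400 * padded_size (apply_update B u)) (program_for algorithm u) (base_load u s)
    (stores (apply_update B u))"
proof -
  define m n where "m = dim_row B" and "n = dim_col B"
  have r: "represents m n s" and A: "\<And>i j. i < m \<Longrightarrow> j < n \<Longrightarrow> mem s arr_A i j = B $$ (i, j)"
    using s by (auto simp: stores_def finished_def m_def n_def)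
  \<comment> \<open>The cost is measured by the result, but a deletion starts from a larger matrix
    and the loops add one more: \<open>Suc (Suc k)\<close> is at most \<open>3 * max 1 k\<close>,
    with equality for \<open>k = 1\<close>. Hence 5400 = 600 * 3 * 3.\<close>
  have size: "c * (x * y) \<le> 5400 * (max 1 k * max 1 l)"
    if "c \<le> 600" "x \<le> 3 * max 1 k" "y \<le> 3 * max 1 l" for c x y k l :: nat
  proof -
    have "c * (x * y) \<le> 600 * ((3 * max 1 k) * (3 * max 1 l))" by (intro mult_le_mono that)
    then show ?thesis by simp
  qed
  show ?thesis
  proof (cases u)
    case (Rank_One x y)
    let ?s = "base_load u s"
    have r': "represents m n ?s" using r Rank_One by (simp add: represents_base_vec)
    show ?thesis
      unfolding Rank_One
    proof (simp only: program_for.simps algorithm_def dyn_algorithm.simps,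
        rule runs_mono[OF runs_rank_one_program[OF r'[unfolded Rank_One]]])
      show "501 * (Suc m * Suc n) \<le> 5400 * padded_size (apply_update B (Rank_One x y))"
        unfolding padded_size_def rank_one_dim by (rule size) (auto simp: m_def n_def)
    next
      fix s' assume "finished m n s' \<and> (\<forall>i<m. \<forall>j<n. mem s' arr_A i j =
        mem (base_load (Rank_One x y) s) arr_A i j + mem (base_load (Rank_One x y) s) arr_u i 0 *
        mem (base_load (Rank_One x y) s) arr_v j 0)"
      then show "stores (apply_update B (Rank_One x y)) s'"
        unfolding stores_def rank_one_dim using A u Rank_One
        by (auto simp: rank_one_index base_vec_def m_def n_def simp del: apply_update.simps)
    qed
  next
    case (Add_Row p x)
    then have p: "p \<le> m" using u by (simp add: m_def)
    have r': "represents m n (base_load (Add_Row p x) s)"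
      using r by (simp add: represents_base_vec represents_set_reg_0)
    have p0: "regs (base_load (Add_Row p x) s) 0 = p" by (simp add: set_reg_def)
    show ?thesis
      unfolding Add_Row
    proof (simp only: program_for.simps algorithm_def dyn_algorithm.simps,
        rule runs_mono[OF runs_add_row_program[OF r' p0 p]])
      show "600 * (Suc (Suc m) * Suc n) \<le> 5400 * padded_size (apply_update B (Add_Row p x))"
        unfolding padded_size_def add_row_dim[OF p[unfolded m_def]] by (rule size) (auto simp: m_def n_def)
    next
      fix s' assume *: "finished (Suc m) n s' \<and>
        (\<forall>i<m. \<forall>j<n. mem s' arr_A (skip p i) j = mem (base_load (Add_Row p x) s) arr_A i j) \<and>
        (\<forall>j<n. mem s' arr_A p j = mem (base_load (Add_Row p x) s) arr_u j 0)"
      have "mem s' arr_A i j = apply_update B (Add_Row p x) $$ (i, j)" if "i < Suc m" "j < n" for i j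
        using that
        by (rule stores_all_rows[OF p, rotated 2])
          (use * A u Add_Row p in \<open>auto simp: add_row_index base_vec_def set_reg_def m_def n_def
            simp del: apply_update.simps\<close>)
      then show "stores (apply_update B (Add_Row p x)) s'"
        unfolding stores_def add_row_dim[OF p[unfolded m_def]] using * by (simp add: m_def n_def)
    qed
  next
    case (Delete_Row p)
    then obtain m' where m': "m = Suc m'" and p: "p \<le> m'" using u by (cases m) (auto simp: m_def)
    have d: "dim_row (apply_update B (Delete_Row p)) = m'" "dim_col (apply_update B (Delete_Row p)) = n"
      using delete_row_dim[of p B] m' p by (simp_all add: m_def n_def del: apply_update.simps)
    have r': "represents (Suc m') n (base_load (Delete_Row p) s)"
      using r m' by (simp add: represents_set_reg_0)
    have p0: "regs (base_load (Delete_Row p) s) 0 = p" by (simp add: set_reg_def)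
    show ?thesis
      unfolding Delete_Row
    proof (simp only: program_for.simps algorithm_def dyn_algorithm.simps,
        rule runs_mono[OF runs_delete_row_program[OF r' p0 p]])
      show "600 * (Suc (Suc m') * Suc n) \<le> 5400 * padded_size (apply_update B (Delete_Row p))"
        unfolding padded_size_def d by (rule size) auto
    next
      fix s' assume *: "finished m' n s' \<and>
        (\<forall>i<m'. \<forall>j<n. mem s' arr_A i j = mem (base_load (Delete_Row p) s) arr_A (skip p i) j)"
      show "stores (apply_update B (Delete_Row p)) s'"
        unfolding stores_def d using * A m' p delete_row_index[of p B] d
        by (auto simp: set_reg_def skip_less m_def n_def simp del: apply_update.simps)
    qed
  next
    case (Add_Col p x)
    then have p: "p \<le> n" using u by (simp add: n_def)
    have r': "represents m n (base_load (Add_Col p x) s)"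
      using r by (simp add: represents_base_vec represents_set_reg_0)
    have p0: "regs (base_load (Add_Col p x) s) 0 = p" by (simp add: set_reg_def)
    show ?thesis
      unfolding Add_Col
    proof (simp only: program_for.simps algorithm_def dyn_algorithm.simps,
        rule runs_mono[OF runs_add_col_program[OF r' p0 p]])
      show "600 * (Suc m * Suc (Suc n)) \<le> 5400 * padded_size (apply_update B (Add_Col p x))"
        unfolding padded_size_def add_col_dim[OF p[unfolded n_def]] by (rule size) (auto simp: m_def n_def)
    next
      fix s' assume *: "finished m (Suc n) s' \<and>
        (\<forall>i<m. \<forall>j<n. mem s' arr_A i (skip p j) = mem (base_load (Add_Col p x) s) arr_A i j) \<and>
        (\<forall>i<m. mem s' arr_A i p = mem (base_load (Add_Col p x) s) arr_u i 0)"
      have "mem s' arr_A i j = apply_update B (Add_Col p x) $$ (i, j)" if "j < Suc n" "i < m" for i j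
        using that
        by (rule stores_all_rows[OF p, where f = "\<lambda>j i. mem s' arr_A i j", rotated 2])
          (use * A u Add_Col p in \<open>auto simp: add_col_index base_vec_def set_reg_def m_def n_def
            simp del: apply_update.simps\<close>)
      then show "stores (apply_update B (Add_Col p x)) s'"
        unfolding stores_def add_col_dim[OF p[unfolded n_def]] using * by (simp add: m_def n_def)
    qed
  next
    case (Delete_Col p)
    then obtain n' where n': "n = Suc n'" and p: "p \<le> n'" using u by (cases n) (auto simp: n_def)
    have d: "dim_row (apply_update B (Delete_Col p)) = m" "dim_col (apply_update B (Delete_Col p)) = n'"
      using delete_col_dim[of p B] n' p by (simp_all add: m_def n_def del: apply_update.simps)
    have r': "represents m (Suc n') (base_load (Delete_Col p) s)"
      using r n' by (simp add: represents_set_reg_0)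
    have p0: "regs (base_load (Delete_Col p) s) 0 = p" by (simp add: set_reg_def)
    show ?thesis
      unfolding Delete_Col
    proof (simp only: program_for.simps algorithm_def dyn_algorithm.simps,
        rule runs_mono[OF runs_delete_col_program[OF r' p0 p]])
      show "600 * (Suc m * Suc (Suc n')) \<le> 5400 * padded_size (apply_update B (Delete_Col p))"
        unfolding padded_size_def d by (rule size) auto
    next
      fix s' assume *: "finished m n' s' \<and>
        (\<forall>i<m. \<forall>j<n'. mem s' arr_A i j = mem (base_load (Delete_Col p) s) arr_A i (skip p j))"
      show "stores (apply_update B (Delete_Col p)) s'"
        unfolding stores_def d using * A n' p delete_col_index[of p B] d
        by (auto simp: set_reg_def skip_less m_def n_def simp del: apply_update.simps)
    qed
  qed
qed

lemma runs_init: "runs \<omega> ((dim_row A + dim_col A + 2) ^ 13) (prog_init algorithm) (base_init Q A) (stores A)"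
  unfolding algorithm_def dyn_algorithm.simps
  by (rule runs_mono[OF runs_init_program[where m = "dim_row A" and n = "dim_col A"]])
    (auto simp: base_init_def stores_def)

section \<open>Passing to the algebraic closure\<close>

definition lift_state :: "'a::field state \<Rightarrow> 'a alg_closure state" where
  "lift_state s = \<lparr>regs = regs s, idx = idx s, mem = (\<lambda>a i j. to_ac (mem s a i j)), drawn = drawn s\<rparr>"

lemma lift_state_simps [simp]:
  "regs (lift_state s) = regs s" "idx (lift_state s) = idx s"
  "mem (lift_state s) a i j = to_ac (mem s a i j)" "drawn (lift_state s) = drawn s"
  by (simp_all add: lift_state_def)

lemma atom_val_lift [simp]: "atom_val (lift_state s) a = atom_val s a"
  by (cases a) auto

lemma get_lift [simp]: "get (lift_state s) x = to_ac (get s x)"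
  by (cases x) auto

lemma put_lift [simp]: "put x (to_ac y) (lift_state s) = lift_state (put x y s)"
  by (cases x, rule state.equality) (simp_all add: fun_eq_iff)

lemma test_val_lift [simp]: "test_val (lift_state s) b \<longleftrightarrow> test_val s b"
  by (induction b) auto

lemma exec_instr_lift: "exec_instr (\<lambda>i. to_ac (\<omega> i)) i (lift_state s) = lift_state (exec_instr \<omega> i s)"
proof (cases i)
  case (FZero x)
  then show ?thesis using put_lift[of x 0 s] by simp
next
  case (FOne x)
  then show ?thesis using put_lift[of x 1 s] by simp
next
  case (FDraw x)
  then show ?thesis by simp (simp add: lift_state_def)
next
  case (FAdd x y z)
  then show ?thesis using put_lift[of x "get s y + get s z" s] by simp
next
  case (FSub x y z)
  then show ?thesis using put_lift[of x "get s y - get s z" s] by simp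
next
  case (FMul x y z)
  then show ?thesis using put_lift[of x "get s y * get s z" s] by simp
next
  case (FDiv x y z)
  then show ?thesis using put_lift[of x "get s y / get s z" s] by simp
qed (simp_all, simp_all add: set_reg_def lift_state_def)

text \<open>\<open>to_ac\<close> is an injective field homomorphism: it commutes with every
  operation, including division by zero, and preserves all zero tests. The lifted run therefore
  takes the same branches and equally many steps.\<close>

lemma big_step_lift:
  "big_step \<omega> c s t s' \<Longrightarrow> big_step (\<lambda>i. to_ac (\<omega> i)) c (lift_state s) t (lift_state s')"
proof (induction rule: big_step.induct)
  case (Do i s)
  then show ?case using big_step.Do[of "\<lambda>i. to_ac (\<omega> i)" i "lift_state s"] by (simp add: exec_instr_lift)
next
  case (Seq c s t s' c' t' s'')
  from Seq.IH show ?case by (rule big_step.Seq)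
next
  case (CondT s b c t s' c')
  show ?case by (rule big_step.CondT) (use CondT in simp_all)
next
  case (CondF s b c' t s' c)
  show ?case by (rule big_step.CondF) (use CondF in simp_all)
next
  case (WhileF s b c)
  show ?case by (rule big_step.WhileF) (use WhileF in simp)
next
  case (WhileT s b c t s' t' s'')
  show ?case by (rule big_step.WhileT[OF _ WhileT.IH]) (use WhileT in simp)
qed

lemma load_update_lift: "load_update u (lift_state s) = lift_state (base_load u s)"
  by (cases u) (auto simp: load_vec_def base_vec_def set_reg_def lift_state_def fun_eq_iff)

lemma initial_state_lift: "initial_state Q A = lift_state (base_init Q A)"
  by (auto simp: initial_state_def base_init_def lift_state_def fun_eq_iff)

text \<open>\<open>history\<close> begins with \<open>B\<close> itself, so entry \<open>i\<close> of
  \<open>rs\<close> belongs to entry \<open>Suc i\<close> of the history.\<close>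

lemma run_updates_algorithm:
  assumes "stores B s" "valid_updates B us"
  shows "\<exists>rs. run_updates algorithm (\<lambda>i. to_ac (\<omega> i)) (lift_state s) us rs \<and>
    map mat_rank (history B us) = mat_rank B # map snd rs \<and>
    (\<forall>i<length us. fst (rs ! i) \<le> 5400 * padded_size (history B us ! Suc i))"
  using assms
proof (induction us arbitrary: B s)
  case Nil
  then show ?case by (auto intro: run_updates.intros)
next
  case (Cons u us)
  obtain t s' where 1: "big_step \<omega> (program_for algorithm u) (base_load u s) t s'"
    "t \<le> 5400 * padded_size (apply_update B u)" "stores (apply_update B u) s'"
    using runs_update[OF Cons.prems(1), of u \<omega>] Cons.prems(2) unfolding runs_def by auto
  obtain rs where 2: "run_updates algorithm (\<lambda>i. to_ac (\<omega> i)) (lift_state s') us rs"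
    "map mat_rank (history (apply_update B u) us) = mat_rank (apply_update B u) # map snd rs"
    "\<forall>i<length us. fst (rs ! i) \<le> 5400 * padded_size (history (apply_update B u) us ! Suc i)"
    using Cons.IH[OF 1(3)] Cons.prems(2) by auto
  have "big_step (\<lambda>i. to_ac (\<omega> i)) (program_for algorithm u) (load_update u (lift_state s)) t (lift_state s')"
    using big_step_lift[OF 1(1)] by (simp add: load_update_lift)
  then have "run_updates algorithm (\<lambda>i. to_ac (\<omega> i)) (lift_state s) (u # us) ((t, regs (lift_state s') 0) # rs)"
    using 2(1) by (rule run_updates.intros)
  moreover have "fst (((t, regs (lift_state s') 0) # rs) ! i) \<le> 5400 * padded_size (history B (u # us) ! Suc i)"
    if "i < length (u # us)" for i
  proof (cases i)
    case 0
    have "history (apply_update B u) us ! 0 = apply_update B u" by (cases us) auto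
    then show ?thesis using 0 1(2) by simp
  next
    case (Suc k)
    then show ?thesis using that 2(3) by simp
  qed
  ultimately show ?case
    using 2(2) stores_answer[OF 1(3)] by (intro exI[of _ "(t, regs (lift_state s') 0) # rs"]) auto
qed

lemma run_algorithm:
  assumes "valid_updates A us" and \<omega>: "\<And>i. \<omega> i \<in> range to_ac"
  shows "\<exists>rs. run algorithm \<omega> Q A us rs \<and> map snd rs = map mat_rank (history A us) \<and>
    fst (rs ! 0) \<le> (dim_row A + dim_col A + 2) ^ 13 \<and>
    (\<forall>i\<in>{1..length us}. fst (rs ! i) \<le> 5400 * padded_size (history A us ! i))"
proof -
  \<comment> \<open>A tape with values in the embedded base field is the image of a tape over
    \<open>'a\<close>, so the run can be obtained by lifting.\<close>
  have "\<exists>\<omega>'. \<forall>i. \<omega> i = to_ac (\<omega>' i)" using \<omega> by (intro choice) auto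
  then obtain \<omega>' where \<omega>': "\<omega> = (\<lambda>i. to_ac (\<omega>' i))" by auto
  obtain t s where 1: "big_step \<omega>' (prog_init algorithm) (base_init Q A) t s"
    "t \<le> (dim_row A + dim_col A + 2) ^ 13" "stores A s"
    using runs_init[of \<omega>' A Q] unfolding runs_def by auto
  obtain rs where 2: "run_updates algorithm \<omega> (lift_state s) us rs"
    "map mat_rank (history A us) = mat_rank A # map snd rs"
    "\<forall>i<length us. fst (rs ! i) \<le> 5400 * padded_size (history A us ! Suc i)"
    using run_updates_algorithm[OF 1(3) assms(1), of \<omega>'] unfolding \<omega>'[symmetric] by metis
  have "big_step \<omega> (prog_init algorithm) (initial_state Q A) t (lift_state s)"
    unfolding initial_state_lift \<omega>' by (rule big_step_lift[OF 1(1)])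
  then have "run algorithm \<omega> Q A us ((t, regs (lift_state s) 0) # rs)"
    using 2(1) by (rule run.intros)
  moreover have "fst (((t, regs (lift_state s) 0) # rs) ! i) \<le> 5400 * padded_size (history A us ! i)"
    if "i \<in> {1..length us}" for i
    using that 2(3)[rule_format, of "i - 1"] by (cases i) auto
  ultimately show ?thesis using 1(2) 2(2) stores_answer[OF 1(3)]
    by (intro exI[of _ "(t, regs (lift_state s) 0) # rs"]) auto
qed

section \<open>The base field as field of computation\<close>

lemma subfield_range_to_ac: "subfield (range to_ac) (ring_of_type_algebra :: 'a::field alg_closure ring)"
proof -
  let ?R = "ring_of_type_algebra :: 'a alg_closure ring"
  have R: "ring ?R" "cring ?R" by (rule ring_from_type_algebra cring_from_type_algebra)+
  \<comment> \<open>The inverse in the additive group of the ring structure is identified with the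
    type class operation by uniqueness.\<close>
  have neg: "\<ominus>\<^bsub>?R\<^esub> x = - x" for x
    by (rule abelian_group.minus_equality[OF ring.is_abelian_group[OF R(1)]])
      (simp_all add: ring_of_type_algebra_def)
  have "subring (range to_ac) ?R"
  proof (rule ring.subringI[OF R(1)])
    show "\<one>\<^bsub>?R\<^esub> \<in> range to_ac"
      using rangeI[of to_ac 1] by (simp add: ring_of_type_algebra_def)
    fix x y :: "'a alg_closure" assume "x \<in> range to_ac" "y \<in> range to_ac"
    then obtain a b where ab: "x = to_ac a" "y = to_ac b" by auto
    show "x \<otimes>\<^bsub>?R\<^esub> y \<in> range to_ac"
      using rangeI[of to_ac "a * b"] by (simp add: ring_of_type_algebra_def ab)
    show "x \<oplus>\<^bsub>?R\<^esub> y \<in> range to_ac"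
      using rangeI[of to_ac "a + b"] by (simp add: ring_of_type_algebra_def ab)
  next
    fix x assume "x \<in> range (to_ac :: 'a \<Rightarrow> _)"
    then show "\<ominus>\<^bsub>?R\<^esub> x \<in> range to_ac" by (auto simp: neg simp flip: to_ac_minus)
  qed (simp add: ring_of_type_algebra_def)
  then have "subcring (range to_ac) ?R" by (rule cring.subcringI'[OF R(2)])
  then show ?thesis
  proof (rule ring.subfieldI[OF R(1)])
    show "Units (?R\<lparr>carrier := range to_ac\<rparr>) = range to_ac - {\<zero>\<^bsub>?R\<^esub>}"
    proof (intro equalityI subsetI)
      fix x assume "x \<in> Units (?R\<lparr>carrier := range to_ac\<rparr>)"
      then show "x \<in> range to_ac - {\<zero>\<^bsub>?R\<^esub>}" by (auto simp: Units_def ring_of_type_algebra_def)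
    next
      fix x assume "x \<in> range to_ac - {\<zero>\<^bsub>?R\<^esub>}"
      then obtain a where a: "x = to_ac a" "a \<noteq> 0" by (auto simp: ring_of_type_algebra_def)
      then show "x \<in> Units (?R\<lparr>carrier := range to_ac\<rparr>)"
        by (auto simp: Units_def ring_of_type_algebra_def intro!: exI[of _ "inverse a"])
    qed
  qed
qed

text \<open>For size 1 every base field is large enough; if it is infinite, the singleton
  \<open>{0}\<close> is an admissible set to draw from.\<close>

lemma computation_field_1: "\<exists>K S :: 'a::field alg_closure set. computation_field 1 K S"
proof (intro exI)
  define K where "K = range (to_ac :: 'a \<Rightarrow> 'a alg_closure)"
  have "subfield K ring_of_type_algebra" unfolding K_def by (rule subfield_range_to_ac)
  moreover have "K \<noteq> {}" "0 \<in> K" using rangeI[of to_ac "0 :: 'a"] by (auto simp: K_def)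
  ultimately show "computation_field 1 K (if finite K then K else {0})"
    using finite_UNIV_card_ge_0[where 'a = 'a] by (auto simp: computation_field_def K_def Suc_le_eq)
qed

text \<open>Size 1 forces \<open>K\<close> to be the embedded base field, so every tape over
  \<open>S\<close> is covered by \<open>run_algorithm\<close>.\<close>

lemma computation_field_1D:
  assumes "computation_field 1 K (S :: 'a::field alg_closure set)"
  shows "S \<subseteq> range to_ac" "finite S" "S \<noteq> {}"
proof -
  have "infinite (UNIV :: 'a set) \<or> 1 \<le> CARD('a)" by (auto simp: Suc_le_eq card_gt_0_iff)
  with assms have K: "K = range to_ac" unfolding computation_field_def by meson
  show "S \<subseteq> range to_ac" "finite S" "S \<noteq> {}"
    using assms K unfolding computation_field_def by (auto split: if_splits)
qed

lemma prob_space_random_tapes: "finite S \<Longrightarrow> S \<noteq> {} \<Longrightarrow> prob_space (random_tapes S)"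
  unfolding random_tapes_def by (intro prob_space_PiM prob_space_uniform_count_measure)

theorem theorem1p2:
  shows "\<exists>(P :: dyn_algorithm) k C e. \<forall>c. \<exists>d. \<forall>m n Q.
    (\<exists>K S :: 'a::field alg_closure set. computation_field ((m + n + Q + 2) ^ d) K S) \<and>
    (\<forall>K S :: 'a alg_closure set. computation_field ((m + n + Q + 2) ^ d) K S \<longrightarrow>
      (\<forall>(A :: 'a mat) us.
        A \<in> carrier_mat m n \<and> valid_updates A us \<and> length us \<le> Q \<longrightarrow>
          within_cost_bounds P k C e S Q A us \<and>
          prob_all_correct P S Q A us \<ge> 1 - 1 / real (m + n + Q + 2) ^ c))"
\<comment> \<open>13 and 5400 come from \<open>runs_init\<close> and \<open>runs_update\<close>, and
  no logarithmic factor is needed. As no answer is ever wrong, \<open>d = 0\<close> serves every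
  \<open>c\<close>; the requested field size is then 1.\<close>
proof (rule exI[of _ algorithm], rule exI[of _ 13], rule exI[of _ 5400], rule exI[of _ 0],
    rule allI, rule exI[of _ 0], intro allI conjI impI; (elim conjE)?)
  fix m n Q :: nat
  show "\<exists>K S :: 'a alg_closure set. computation_field ((m + n + Q + 2) ^ 0) K S"
    using computation_field_1 by auto
  fix c :: nat and K S :: "'a alg_closure set" and A :: "'a mat" and us
  assume "computation_field ((m + n + Q + 2) ^ 0) K S" and us: "valid_updates A us"
  then have "computation_field 1 K S" by (simp only: power_0)
  note S = computation_field_1D[OF this]
  have run: "\<exists>rs. run algorithm \<omega> Q A us rs \<and> map snd rs = map mat_rank (history A us) \<and>
      fst (rs ! 0) \<le> (dim_row A + dim_col A + 2) ^ 13 \<and>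
      (\<forall>i\<in>{1..length us}. fst (rs ! i) \<le> 5400 * padded_size (history A us ! i))"
    if "\<omega> \<in> space (random_tapes S)" for \<omega>
    using that S by (intro run_algorithm[OF us])
      (auto simp: random_tapes_def space_PiM space_uniform_count_measure)
  \<comment> \<open>With exponent 0 the logarithmic factor is 1, and \<open>soft_mn\<close> reduces
    to \<open>padded_size\<close>.\<close>
  have "real t \<le> real 5400 * soft_mn 0 B" if "t \<le> 5400 * padded_size B" for t and B :: "'a mat"
    using of_nat_mono[OF that, where 'a = real] by (simp add: soft_mn_def padded_size_def Let_def)
  then show "within_cost_bounds algorithm 13 5400 0 S Q A us"
    unfolding within_cost_bounds_def using run by meson
  \<comment> \<open>Every tape succeeds, so the event is the whole space and its measurability needs
    no separate argument.\<close>
  have "{\<omega> \<in> space (random_tapes S).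
      \<exists>rs. run algorithm \<omega> Q A us rs \<and> map snd rs = map mat_rank (history A us)} = space (random_tapes S)"
    using run by blast
  then have "prob_all_correct algorithm S Q A us = 1"
    using prob_space.prob_space[OF prob_space_random_tapes[OF S(2,3)]] by (simp add: prob_all_correct_def)
  then show "1 - 1 / real (m + n + Q + 2) ^ c \<le> prob_all_correct algorithm S Q A us" by simp
qed

end
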